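(* Let $P$ be a fixed (i.e. with number of entries constant, independent of $n$) non-empty partial Latin square with $m(P)>1/2$. Let $\mathbf{L}$ be a random Latin square of order $n$. Then the probability that $\mathbf{L}$ contains an isotopic copy of $P$ tends to $1$ as $n\to\infty$.
   Context: A partial Latin square of order $n$ is an $n\times n$ matrix (rows, columns and symbols indexed by $[n]=\{1,\dots,n\}$) in which each cell is either empty or filled with one of the $n$ symbols, with no symbol repeated in any row or column; it is a Latin square if every cell is filled. A partial Latin square $P$ is identified with its set of entries $(r,c,s)$ (cell $(r,c)$ contains symbol $s$), so $|P|$ is the number of non-empty cells; $P'\subseteq P$ refers to subsets of entries, and a Latin square $L$ contains $P$ if $L\supseteq P$ as sets of entries. A fixed $P$ is regarded as a partial Latin square of order $n$ for all sufficiently large $n$. $\mathcal{R}_P,\mathcal{C}_P,\mathcal{S}_P$ are the sets of rows, columns and symbols, respectively, appearing in entries of $P$. For non-empty $P$ the density is \[ m(P):=\min\left\{\frac{|\mathcal{R}_{P'}|+|\mathcal{C}_{P'}|+|\mathcal{S}_{P'}|-|P'|}{|P'|}:\emptyset\ne P'\subseteq P\right\}. \] Two partial Latin squares of order $n$ are isotopic if one can be mapped to the other by permutations of the row set $[n]$, the column set $[n]$ and the symbol set $[n]$. A random Latin square of order $n$ is chosen uniformly from all Latin squares of order $n$. *)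

theory Defs
  imports "HOL-Probability.Probability" "HOL-Combinatorics.Permutations"
begin

text \<open>An entry \<open>(r, c, s)\<close> says that the cell in row \<open>r\<close> and column \<open>c\<close> contains the symbol \<open>s\<close>;
  a partial Latin square is identified with its set of entries.\<close>

type_synonym entry = "nat \<times> nat \<times> nat"

text \<open>The three uniqueness conditions say: a cell contains at most one symbol, no symbol is repeated
  in a row, and no symbol is repeated in a column.\<close>

definition partial_latin_square :: "nat \<Rightarrow> entry set \<Rightarrow> bool" where
  "partial_latin_square n P \<longleftrightarrow>
     P \<subseteq> {1..n} \<times> {1..n} \<times> {1..n} \<and>
     (\<forall>r c s s'. (r, c, s) \<in> P \<and> (r, c, s') \<in> P \<longrightarrow> s = s') \<and>
     (\<forall>r c c' s. (r, c, s) \<in> P \<and> (r, c', s) \<in> P \<longrightarrow> c = c') \<and>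
     (\<forall>r r' c s. (r, c, s) \<in> P \<and> (r', c, s) \<in> P \<longrightarrow> r = r')"

definition latin_square :: "nat \<Rightarrow> entry set \<Rightarrow> bool" where
  "latin_square n L \<longleftrightarrow>
     partial_latin_square n L \<and> (\<forall>r\<in>{1..n}. \<forall>c\<in>{1..n}. \<exists>s. (r, c, s) \<in> L)"

definition rows_of :: "entry set \<Rightarrow> nat set" where
  "rows_of P = {r. \<exists>c s. (r, c, s) \<in> P}"

definition cols_of :: "entry set \<Rightarrow> nat set" where
  "cols_of P = {c. \<exists>r s. (r, c, s) \<in> P}"

definition syms_of :: "entry set \<Rightarrow> nat set" where
  "syms_of P = {s. \<exists>r c. (r, c, s) \<in> P}"

text \<open>Meaningful for finite non-empty \<open>P\<close>, where the minimum is over a finite non-empty set.\<close>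

definition pls_density :: "entry set \<Rightarrow> real" where
  "pls_density P =
     Min {(real (card (rows_of P')) + real (card (cols_of P')) + real (card (syms_of P'))
             - real (card P')) / real (card P') | P'. P' \<noteq> {} \<and> P' \<subseteq> P}"

definition isotopic :: "nat \<Rightarrow> entry set \<Rightarrow> entry set \<Rightarrow> bool" where
  "isotopic n P Q \<longleftrightarrow>
     partial_latin_square n P \<and> partial_latin_square n Q \<and>
     (\<exists>\<rho> \<gamma> \<sigma>. \<rho> permutes {1..n} \<and> \<gamma> permutes {1..n} \<and> \<sigma> permutes {1..n} \<and>
        Q = (\<lambda>(r, c, s). (\<rho> r, \<gamma> c, \<sigma> s)) ` P)"

definition random_latin_square :: "nat \<Rightarrow> entry set pmf" where
  "random_latin_square n = pmf_of_set {L. latin_square n L}"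

text \<open>The uniform distribution \<open>pmf_of_set\<close> is only meaningful on a finite non-empty set.\<close>

lemma finite_latin_squares: "finite {L. latin_square n L}"
  by (rule finite_subset[of _ "Pow ({1..n} \<times> {1..n} \<times> {1..n})"])
     (auto simp: latin_square_def partial_latin_square_def)

lemma cyclic_cancel:
  fixes a b c n :: nat
  assumes "(a + b) mod n = (a + c) mod n" "b \<in> {1..n}" "c \<in> {1..n}"
  shows "b = c"
proof -
  have *: "x = y" if "x \<le> y" "(a + x) mod n = (a + y) mod n" "x \<in> {1..n}" "y \<in> {1..n}"
    for x y :: nat
  proof -
    have "n dvd (a + y) - (a + x)"
      using that(1,2) mod_eq_dvd_iff_nat[of "a + x" "a + y" n] by (metis add_left_mono)
    then have "n dvd y - x" by simp
    moreover have "y - x < n" using that by auto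
    ultimately show ?thesis using that(1) by (auto dest: dvd_imp_le)
  qed
  show ?thesis using *[of b c] *[of c b] assms by (metis nat_le_linear)
qed

lemma latin_squares_nonempty: "{L. latin_square n L} \<noteq> {}"
proof -
  define L :: "entry set"
    where "L = {(r, c, Suc ((r + c) mod n)) | r c. r \<in> {1..n} \<and> c \<in> {1..n}}"
  have "latin_square n L"
    unfolding latin_square_def partial_latin_square_def
  proof (intro conjI allI impI ballI)
    show "L \<subseteq> {1..n} \<times> {1..n} \<times> {1..n}"
      by (auto simp: L_def Suc_le_eq)
  next
    fix r c c' s assume "(r, c, s) \<in> L \<and> (r, c', s) \<in> L"
    then show "c = c'"
      by (auto simp: L_def intro: cyclic_cancel[of r _ n])
  next
    fix r r' c s assume "(r, c, s) \<in> L \<and> (r', c, s) \<in> L"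
    then show "r = r'"
      by (auto simp: L_def add.commute[of _ c] intro: cyclic_cancel[of c _ n])
  qed (auto simp: L_def)
  then show ?thesis by blast
qed

end

theory Submission
  imports Defs
begin

text \<open>
  A map from the lines (rows, columns, symbols) of \<open>P\<close> to those of a Latin square \<open>L\<close> that sends entries to
  entries is built one entry at a time. Since \<open>m(P) > 1/2\<close>, every non-empty part of \<open>P\<close> has an entry with a
  line of its own; so such maps are abundant in every \<open>L\<close>, about \<open>n ^ (v - e)\<close> of them with \<open>v\<close> lines and
  \<open>e\<close> entries, and the only obstacle to injectivity is that the last line of an entry, forced by
  the other two, coincides with a line already used.

  If a positive proportion of the maps is obstructed in this way, then \<open>L\<close> is compressible. Reveal a suitable
  set of cells: for a positive proportion of the remaining cells, the entry is among boundedly many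
  symbols that the revealed part predicts often. (A cell receives at most the average number of
  predictions, because the degeneracy of \<open>P\<close> can be rooted at any of its entries.) Hence there are at most
  \<open>n ^ ((1 - \<delta>) n\<^sup>2)\<close> such Latin squares. On the other hand there are at least \<open>(n / e\<^sup>2) ^ n\<^sup>2\<close>
  Latin squares in total, by adding rows and bounding permanents with Gurvits's capacity argument. The
  log-concavity it needs is obtained combinatorially, by exchanging two matchings along an alternating path.
\<close>

section \<open>Permanents of regular bipartite graphs\<close>

text \<open>For e entries on v lines, density above 1/2 means 2 v > 3 e, while 2 v \<le> 3 e as soon
  as every line lies on two of the entries; this is where the lines of one's own come from. Removing
  an entry together with such a line leaves v - e unchanged, so the main term n ^ (v - e) is the
  same throughout the induction and only obstructed maps are subtracted.

  The accounting is in factors per cell. A predicted cell is described by one of O(1) symbols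
  instead of one of n, which saves a factor of order n ^ (\<delta> n ^ 2) in total, up to C ^ (n ^
  2). Such a saving beats C ^ (n ^ 2) for every constant C, so it pays for naming the revealed and
  the predicted cells and for the constant in the lower bound on the number of Latin squares. That
  lower bound must, however, have the right power n ^ (n ^ 2); this is what the permanents are for.
  The encoding works for every positive proportion of obstructed maps, however small, so the
  finitely many possible obstructions to an entry, one for each line of the same type already
  placed, can share an arbitrary \<epsilon>.\<close>

definition injections :: "'b set \<Rightarrow> 'a set \<Rightarrow> ('b \<Rightarrow> 'a) set" where
  "injections S R = {g \<in> S \<rightarrow>\<^sub>E R. inj_on g S}"

text \<open>The first index of \<open>a\<close> is the row. For \<open>card S = card R\<close> this
  is the permanent; fewer columns are needed because columns are treated one at a time.\<close>

definition mat_sum :: "('a \<Rightarrow> 'b \<Rightarrow> real) \<Rightarrow> 'b set \<Rightarrow> 'a set \<Rightarrow> real" where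
  "mat_sum a S R = (\<Sum>g\<in>injections S R. \<Prod>j\<in>S. a (g j) j)"

lemma finite_injections [simp]: "finite S \<Longrightarrow> finite R \<Longrightarrow> finite (injections S R)"
  by (simp add: injections_def finite_PiE)

lemma mat_sum_nonneg: "(\<And>i j. a i j \<ge> 0) \<Longrightarrow> mat_sum a S R \<ge> 0"
  by (auto simp: mat_sum_def intro!: sum_nonneg prod_nonneg)

lemma mat_sum_mono:
  assumes "\<And>i j. a i j \<ge> 0" "finite S" "finite R" "R' \<subseteq> R"
  shows "mat_sum a S R' \<le> mat_sum a S R"
  unfolding mat_sum_def
proof (rule sum_mono2)
  show "injections S R' \<subseteq> injections S R"
    using assms(4) by (auto simp: injections_def)
qed (auto intro: prod_nonneg assms finite_injections)

lemma mat_sum_pos: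
  assumes "\<And>i j. a i j > 0" "finite S" "finite R" "card S \<le> card R"
  shows "mat_sum a S R > 0"
proof -
  obtain f where f: "inj_on f S" "f ` S \<subseteq> R"
    using card_le_inj[OF assms(2,3,4)] by auto
  have "restrict f S \<in> injections S R"
    using f by (auto simp: injections_def)
  then have "injections S R \<noteq> {}" by blast
  then show ?thesis
    unfolding mat_sum_def using assms by (intro sum_pos prod_pos) auto
qed

text \<open>The columns on the alternating path that starts at \<open>r\<close> and leaves rows along \<open>q\<close>
  and columns along \<open>p\<close>.\<close>

inductive_set alt_path :: "'b set \<Rightarrow> 'a \<Rightarrow> ('b \<Rightarrow> 'a) \<Rightarrow> ('b \<Rightarrow> 'a) \<Rightarrow> 'b set"
  for S r p q where
  start: "j \<in> S \<Longrightarrow> q j = r \<Longrightarrow> j \<in> alt_path S r p q"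
| step: "i \<in> alt_path S r p q \<Longrightarrow> j \<in> S \<Longrightarrow> q j = p i \<Longrightarrow> j \<in> alt_path S r p q"

text \<open>Only rows of one and the same column are exchanged, so the product of the weights of the
  two maps is unchanged.\<close>

definition path_swap :: "'b set \<Rightarrow> 'a \<Rightarrow> ('b \<Rightarrow> 'a) \<times> ('b \<Rightarrow> 'a) \<Rightarrow> ('b \<Rightarrow> 'a) \<times> ('b \<Rightarrow> 'a)" where
  "path_swap S r = (\<lambda>(f, g).
     (\<lambda>j. if j \<in> alt_path S r g f then g j else f j,
      \<lambda>j. if j \<in> alt_path S r g f then f j else g j))"

lemma alt_path_subset: "j \<in> alt_path S r p q \<Longrightarrow> j \<in> S"
  by (induction rule: alt_path.induct) auto

text \<open>The path leaves \<open>r\<close> through \<open>f\<close> and reaches every later row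
  through \<open>g\<close>, which avoids \<open>r'\<close>. Hence \<open>f\<close> does not use
  \<open>r'\<close> on the path; after the exchange the first map has given up \<open>r\<close>, and
  the second may have gained \<open>r\<close> but not \<open>r'\<close>.\<close>

lemma path_swap_mem:
  assumes f: "f \<in> injections S R" and g: "g \<in> injections S (R - {r} - {r'})"
    and "r \<noteq> r'" and s: "path_swap S r (f, g) = (f', g')"
  shows "f' \<in> injections S (R - {r})" "g' \<in> injections S (R - {r'})"
proof -
  let ?C = "alt_path S r g f"
  have f': "f' j = (if j \<in> ?C then g j else f j)" and g': "g' j = (if j \<in> ?C then f j else g j)" for j
    using s by (auto simp: path_swap_def)
  have fi: "inj_on f S" "\<And>j. j \<in> S \<Longrightarrow> f j \<in> R" "\<And>j. j \<notin> S \<Longrightarrow> f j = undefined"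
    using f by (auto simp: injections_def PiE_iff extensional_def)
  have gi: "inj_on g S" "\<And>j. j \<in> S \<Longrightarrow> g j \<in> R - {r} - {r'}" "\<And>j. j \<notin> S \<Longrightarrow> g j = undefined"
    using g by (auto simp: injections_def PiE_iff extensional_def)
  note C = alt_path_subset[of _ S r g f]
  have cl: "i' \<in> ?C" if "i \<in> ?C" "i' \<in> S" "f i' = g i" for i i'
    using that by (metis alt_path.step)
  \<comment> \<open>Backwards along the path: \<open>i'\<close> is not a starting column because
    \<open>g\<close> avoids \<open>r\<close>, and by injectivity of \<open>g\<close> it can only
    have been reached from \<open>i\<close>.\<close>
  have cl2: "i \<in> ?C" if "i' \<in> ?C" "i \<in> S" "f i' = g i" for i i'
    using that(1)
  proof cases
    case start
    then show ?thesis using gi(2)[OF that(2)] that(3) by auto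
  next
    case (step k)
    then have "g k = g i" using that(3) by simp
    then have "k = i" using inj_onD[OF gi(1)] C[OF step(1)] that(2) by blast
    then show ?thesis using step by simp
  qed
  have fC: "f i \<noteq> r'" if "i \<in> ?C" for i
    using that
  proof cases
    case start
    then show ?thesis using \<open>r \<noteq> r'\<close> by auto
  next
    case (step k)
    then show ?thesis using gi(2)[of k] C by auto
  qed
  have fnC: "f i \<noteq> r" if "i \<in> S" "i \<notin> ?C" for i
    using that by (meson alt_path.start)
  have "inj_on f' S"
  proof (rule inj_onI)
    fix x y assume xy: "x \<in> S" "y \<in> S" "f' x = f' y"
    consider "x \<in> ?C" "y \<in> ?C" | "x \<in> ?C" "y \<notin> ?C" | "x \<notin> ?C" "y \<in> ?C" | "x \<notin> ?C" "y \<notin> ?C"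
      by blast
    then show "x = y"
    proof cases
      case 1 then show ?thesis using xy f'[of x] f'[of y] inj_onD[OF gi(1)] by simp
    next
      case 2 then show ?thesis using xy f'[of x] f'[of y] cl[of x y] by simp
    next
      case 3 then show ?thesis using xy f'[of x] f'[of y] cl[of y x] by simp
    next
      case 4 then show ?thesis using xy f'[of x] f'[of y] inj_onD[OF fi(1)] by simp
    qed
  qed
  moreover have "f' \<in> S \<rightarrow>\<^sub>E R - {r}"
  proof (rule PiE_I)
    fix x assume "x \<in> S"
    then show "f' x \<in> R - {r}" using f'[of x] fi(2)[of x] gi(2)[of x] fnC[of x] by auto
  next
    fix x assume "x \<notin> S"
    then show "f' x = undefined" using f'[of x] fi(3)[of x] C[of x] by auto
  qed
  ultimately show "f' \<in> injections S (R - {r})" by (simp add: injections_def)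
  have "inj_on g' S"
  proof (rule inj_onI)
    fix x y assume xy: "x \<in> S" "y \<in> S" "g' x = g' y"
    consider "x \<in> ?C" "y \<in> ?C" | "x \<in> ?C" "y \<notin> ?C" | "x \<notin> ?C" "y \<in> ?C" | "x \<notin> ?C" "y \<notin> ?C"
      by blast
    then show "x = y"
    proof cases
      case 1 then show ?thesis using xy g'[of x] g'[of y] inj_onD[OF fi(1)] by simp
    next
      case 2 then show ?thesis using xy g'[of x] g'[of y] cl2[of x y] by simp
    next
      case 3 then show ?thesis using xy g'[of x] g'[of y] cl2[of y x] by simp
    next
      case 4 then show ?thesis using xy g'[of x] g'[of y] inj_onD[OF gi(1)] by simp
    qed
  qed
  moreover have "g' \<in> S \<rightarrow>\<^sub>E R - {r'}"
  proof (rule PiE_I)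
    fix x assume "x \<in> S"
    then show "g' x \<in> R - {r'}" using g'[of x] fi(2)[of x] gi(2)[of x] fC[of x] by auto
  next
    fix x assume "x \<notin> S"
    then show "g' x = undefined" using g'[of x] gi(3)[of x] C[of x] by auto
  qed
  ultimately show "g' \<in> injections S (R - {r'})" by (simp add: injections_def)
qed

text \<open>On the path the new maps are the old ones with roles exchanged, so the same edges trace
  the same path. The path can thus be read off the result, which makes the exchange
  injective.\<close>

lemma alt_path_swap:
  assumes f: "f \<in> injections S R" and g: "g \<in> injections S (R - {r} - {r'})"
    and s: "path_swap S r (f, g) = (f', g')"
  shows "alt_path S r f' g' = alt_path S r g f"
proof -
  let ?C = "alt_path S r g f"
  have f': "f' j = (if j \<in> ?C then g j else f j)" and g': "g' j = (if j \<in> ?C then f j else g j)" for j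
    using s by (auto simp: path_swap_def)
  have gi: "inj_on g S" "\<And>j. j \<in> S \<Longrightarrow> g j \<in> R - {r} - {r'}"
    using g by (auto simp: injections_def)
  have "j \<in> ?C" if "j \<in> alt_path S r f' g'" for j
    using that
  proof induction
    case (start j)
    then show ?case using g'[of j] gi(2)[of j] by (auto split: if_splits)
  next
    case (step i j)
    then show ?case using g'[of j] f'[of i] gi(1) alt_path_subset[OF step.IH]
      by (auto split: if_splits dest: inj_onD)
  qed
  moreover have "j \<in> ?C \<and> j \<in> alt_path S r f' g'" if "j \<in> ?C" for j
    using that
  proof induction
    case (start j)
    then have "j \<in> ?C" by (rule alt_path.start)
    then show ?case using g'[of j] start by (auto intro: alt_path.start)
  next
    case (step i j)
    then have "j \<in> ?C" by (metis alt_path.step)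
    then show ?case using g'[of j] f'[of i] step by (metis alt_path.step)
  qed
  ultimately show ?thesis by blast
qed

text \<open>Read \<open>mat_sum a S (R - X) / mat_sum a S R\<close> as the probability that a random
  weighted injection avoids \<open>X\<close>. Avoiding \<open>r\<close> and avoiding
  \<open>r'\<close> are then negatively correlated, because \<open>path_swap\<close> maps the pairs
  counted on the left injectively, with equal weight, to pairs counted on the right.\<close>

lemma mat_sum_negative_correlation:
  assumes a: "\<And>i j. a i j \<ge> 0" and fin: "finite S" "finite R" and "r \<noteq> r'"
  shows "mat_sum a S R * mat_sum a S (R - {r} - {r'}) \<le> mat_sum a S (R - {r}) * mat_sum a S (R - {r'})"
proof -
  let ?X = "injections S R \<times> injections S (R - {r} - {r'})"
  let ?Y = "injections S (R - {r}) \<times> injections S (R - {r'})"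
  define w where "w = (\<lambda>(f, g). (\<Prod>j\<in>S. a (f j) j) * (\<Prod>j\<in>S. a (g j) j))"
  have sub: "path_swap S r ` ?X \<subseteq> ?Y"
  proof
    fix y assume "y \<in> path_swap S r ` ?X"
    then obtain f g where fg: "f \<in> injections S R" "g \<in> injections S (R - {r} - {r'})" "y = path_swap S r (f, g)"
      by auto
    obtain f' g' where y: "path_swap S r (f, g) = (f', g')" by fastforce
    show "y \<in> ?Y" using path_swap_mem[OF fg(1,2) \<open>r \<noteq> r'\<close> y] fg(3) y by auto
  qed
  have inj: "inj_on (path_swap S r) ?X"
  proof (rule inj_onI)
    fix x y assume x: "x \<in> ?X" and y: "y \<in> ?X" and eq: "path_swap S r x = path_swap S r y"
    obtain f g where xf: "x = (f, g)" by fastforce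
    obtain h k where yh: "y = (h, k)" by fastforce
    obtain f' g' where e1: "path_swap S r (f, g) = (f', g')" by fastforce
    have e2: "path_swap S r (h, k) = (f', g')" using eq xf yh e1 by simp
    have C1: "alt_path S r f' g' = alt_path S r g f"
      using alt_path_swap[of f S R g r r'] x xf e1 by auto
    have C2: "alt_path S r f' g' = alt_path S r k h"
      using alt_path_swap[of h S R k r r'] y yh e2 by auto
    have CC: "alt_path S r k h = alt_path S r g f" using C1 C2 by simp
    have m1: "f' j = (if j \<in> alt_path S r g f then g j else f j)"
      "g' j = (if j \<in> alt_path S r g f then f j else g j)" for j
      using e1 by (auto simp: path_swap_def)
    have m2: "f' j = (if j \<in> alt_path S r g f then k j else h j)"
      "g' j = (if j \<in> alt_path S r g f then h j else k j)" for j
      using e2 by (auto simp: path_swap_def CC)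
    have "f j = h j \<and> g j = k j" for j using m1[of j] m2[of j] by (auto split: if_splits)
    then show "x = y" using xf yh by auto
  qed
  have weq: "w (path_swap S r x) = w x" for x
  proof -
    obtain f g where xf: "x = (f, g)" by fastforce
    show ?thesis
      unfolding xf w_def path_swap_def case_prod_conv prod.distrib[symmetric]
      by (rule prod.cong) auto
  qed
  have "mat_sum a S R * mat_sum a S (R - {r} - {r'}) = sum w ?X"
    by (simp add: mat_sum_def w_def sum_product sum.cartesian_product)
  also have "\<dots> = sum w (path_swap S r ` ?X)"
    by (simp add: sum.reindex[OF inj] weq)
  also have "\<dots> \<le> sum w ?Y"
    using sub by (rule sum_mono2[rotated])
      (use fin a in \<open>auto simp: w_def intro!: mult_nonneg_nonneg prod_nonneg\<close>)
  also have "\<dots> = mat_sum a S (R - {r}) * mat_sum a S (R - {r'})"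
    by (simp add: mat_sum_def w_def sum_product sum.cartesian_product)
  finally show ?thesis .
qed

text \<open>In the same reading, avoiding all of \<open>X\<close> makes avoiding \<open>r\<close> no
  more likely. The induction cancels \<open>mat_sum a S (R - X)\<close>, hence the separate case in
  which it vanishes.\<close>

lemma mat_sum_remove_set:
  assumes a: "\<And>i j. a i j \<ge> 0" and fin: "finite S" "finite R" and "finite X" "r \<notin> X"
  shows "mat_sum a S (R - X - {r}) * mat_sum a S R \<le> mat_sum a S (R - X) * mat_sum a S (R - {r})"
  using assms(4,5)
proof (induction X)
  case (insert y X)
  let ?M = "mat_sum a S"
  note nn = mat_sum_nonneg[of a S, OF a]
  have e: "R - insert y X = R - X - {y}" by auto
  have 1: "?M (R - X) * ?M (R - X - {y} - {r}) \<le> ?M (R - X - {y}) * ?M (R - X - {r})"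
    using mat_sum_negative_correlation[OF a fin(1), of "R - X" y r] insert fin by auto
  have 2: "?M (R - X - {r}) * ?M R \<le> ?M (R - X) * ?M (R - {r})" using insert by auto
  show ?case
  proof (cases "?M (R - X) = 0")
    case True
    have "?M (R - X - {y} - {r}) \<le> ?M (R - X)" using a fin by (intro mat_sum_mono) auto
    then have "?M (R - X - {y} - {r}) = 0" using True nn[of "R - X - {y} - {r}"] by simp
    then show ?thesis unfolding e using nn by auto
  next
    case False
    then have pos: "?M (R - X) > 0" using nn[of "R - X"] by simp
    have "?M (R - X) * (?M (R - X - {y} - {r}) * ?M R) \<le> ?M (R - X - {y}) * (?M (R - X - {r}) * ?M R)"
      using mult_right_mono[OF 1 nn[of R]] by (simp add: mult_ac)
    also have "\<dots> \<le> ?M (R - X - {y}) * (?M (R - X) * ?M (R - {r}))"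
      by (intro mult_left_mono 2 nn)
    finally have "?M (R - X) * (?M (R - X - {y} - {r}) * ?M R) \<le> ?M (R - X) * (?M (R - X - {y}) * ?M (R - {r}))"
      by (simp add: mult_ac)
    then show ?thesis using pos e by simp
  qed
qed (simp add: mult.commute)

text \<open>This is the form in which log-concavity enters: the coefficients in
  \<open>weighted_sum_expand\<close> are dominated by those of a product of factors 1 + y, and such
  a product is at most the exponential of the sum of the y.\<close>

lemma mat_sum_submultiplicative:
  assumes a: "\<And>i j. a i j \<ge> 0" and fin: "finite S" "finite R" and "finite X"
    and pos: "mat_sum a S R > 0"
  shows "mat_sum a S (R - X) / mat_sum a S R \<le> (\<Prod>r\<in>X. mat_sum a S (R - {r}) / mat_sum a S R)"
  using assms(4)
proof (induction X)
  case (insert y X)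
  let ?M = "mat_sum a S"
  note nn = mat_sum_nonneg[of a S, OF a]
  have e: "R - insert y X = R - X - {y}" by auto
  have "?M (R - insert y X) / ?M R \<le> (?M (R - {y}) / ?M R) * (?M (R - X) / ?M R)"
    using mat_sum_remove_set[OF a fin insert(1,2)] pos unfolding e by (simp add: field_simps)
  also have "\<dots> \<le> (?M (R - {y}) / ?M R) * (\<Prod>r\<in>X. ?M (R - {r}) / ?M R)"
    by (intro mult_left_mono insert.IH divide_nonneg_nonneg nn)
  finally show ?case using insert by simp
qed (use pos in simp)

text \<open>With \<open>v i\<close> the sum of \<open>a i j * x j\<close> over the columns outside
  \<open>S\<close>, this is the coefficient of the product of the x j, j in \<open>S\<close>, in the
  product of the row forms: the mixed derivative of Gurvits's polynomial, taken at 0 in the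
  variables of \<open>S\<close>.\<close>

definition weighted_sum :: "('a \<Rightarrow> 'b \<Rightarrow> real) \<Rightarrow> 'b set \<Rightarrow> 'a set \<Rightarrow> ('a \<Rightarrow> real) \<Rightarrow> real" where
  "weighted_sum a S R v = (\<Sum>g\<in>injections S R. (\<Prod>j\<in>S. a (g j) j) * (\<Prod>i\<in>R - g ` S. v i))"

lemma injections_image: "g \<in> injections S R \<Longrightarrow> g ` S \<subseteq> R" "g \<in> injections S R \<Longrightarrow> inj_on g S"
  by (auto simp: injections_def)

lemma weighted_sum_normalize:
  assumes b: "\<And>i. b i > 0" and fin: "finite S" "finite R"
  shows "weighted_sum a S R (\<lambda>i. b i * c i) = (\<Prod>i\<in>R. b i) * weighted_sum (\<lambda>i j. a i j / b i) S R c"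
  unfolding weighted_sum_def sum_distrib_left
proof (rule sum.cong[OF refl])
  fix g assume g: "g \<in> injections S R"
  note gi = injections_image[OF g]
  have "(\<Prod>i\<in>R. b i) = (\<Prod>i\<in>R - g ` S. b i) * (\<Prod>i\<in>g ` S. b i)"
    using gi fin by (simp add: prod.subset_diff)
  also have "(\<Prod>i\<in>g ` S. b i) = (\<Prod>j\<in>S. b (g j))"
    using prod.reindex[OF gi(2), of b] by simp
  finally have e: "(\<Prod>i\<in>R. b i) = (\<Prod>i\<in>R - g ` S. b i) * (\<Prod>j\<in>S. b (g j))" .
  have "(\<Prod>j\<in>S. b (g j)) * (\<Prod>j\<in>S. a (g j) j / b (g j)) = (\<Prod>j\<in>S. a (g j) j)"
    unfolding prod.distrib[symmetric] using b by (intro prod.cong) (auto simp: less_imp_neq[symmetric])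
  then show "(\<Prod>j\<in>S. a (g j) j) * (\<Prod>i\<in>R - g ` S. b i * c i) =
      (\<Prod>i\<in>R. b i) * ((\<Prod>j\<in>S. a (g j) j / b (g j)) * (\<Prod>i\<in>R - g ` S. c i))"
    unfolding e by (simp add: prod.distrib mult_ac)
qed

lemma injections_Diff: "injections S (R - X) = {g \<in> injections S R. X \<inter> g ` S = {}}"
  by (auto simp: injections_def PiE_iff)

lemma weighted_sum_expand:
  assumes fin: "finite S" "finite R"
  shows "weighted_sum a S R (\<lambda>i. 1 + c i) = (\<Sum>X\<in>Pow R. (\<Prod>i\<in>X. c i) * mat_sum a S (R - X))"
proof -
  have "weighted_sum a S R (\<lambda>i. 1 + c i)
      = (\<Sum>g\<in>injections S R. \<Sum>X\<in>Pow (R - g ` S). (\<Prod>i\<in>X. c i) * (\<Prod>j\<in>S. a (g j) j))"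
    unfolding weighted_sum_def
  proof (rule sum.cong[OF refl])
    fix g
    have "(\<Prod>i\<in>R - g ` S. 1 + c i) = (\<Sum>X\<in>Pow (R - g ` S). \<Prod>i\<in>X. c i)"
      using prod_add[of "R - g ` S" c "\<lambda>_. 1"] fin by (simp add: add.commute)
    then show "(\<Prod>j\<in>S. a (g j) j) * (\<Prod>i\<in>R - g ` S. 1 + c i)
        = (\<Sum>X\<in>Pow (R - g ` S). (\<Prod>i\<in>X. c i) * (\<Prod>j\<in>S. a (g j) j))"
      by (simp add: sum_distrib_left mult.commute)
  qed
  also have "\<dots> = (\<Sum>g\<in>injections S R. \<Sum>X | X \<in> Pow R \<and> X \<inter> g ` S = {}.
      (\<Prod>i\<in>X. c i) * (\<Prod>j\<in>S. a (g j) j))"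
    by (intro sum.cong) auto
  also have "\<dots> = (\<Sum>X\<in>Pow R. \<Sum>g | g \<in> injections S R \<and> X \<inter> g ` S = {}.
      (\<Prod>i\<in>X. c i) * (\<Prod>j\<in>S. a (g j) j))"
    by (rule sum.swap_restrict) (use fin in auto)
  also have "\<dots> = (\<Sum>X\<in>Pow R. (\<Prod>i\<in>X. c i) * mat_sum a S (R - X))"
    by (intro sum.cong refl) (auto simp: mat_sum_def injections_Diff sum_distrib_left)
  finally show ?thesis .
qed

lemma mat_sum_insert:
  assumes "t \<notin> S" "finite S" "finite R"
  shows "mat_sum a (insert t S) R = (\<Sum>r\<in>R. a r t * mat_sum a S (R - {r}))"
proof -
  let ?X = "SIGMA r:R. injections S (R - {r})"
  have bij: "bij_betw (\<lambda>(r, g). g(t := r)) ?X (injections (insert t S) R)"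
    unfolding bij_betw_def
  proof
    show "inj_on (\<lambda>(r, g). g(t := r)) ?X"
    proof (rule inj_onI, clarsimp)
      fix r g r' g'
      assume g: "g \<in> injections S (R - {r})" "g' \<in> injections S (R - {r'})" and e: "g(t := r) = g'(t := r')"
      have "g t = undefined" "g' t = undefined" using g assms by (auto simp: injections_def PiE_def extensional_def)
      moreover have "r = r'" using fun_cong[OF e, of t] by simp
      moreover have "g j = g' j" if "j \<noteq> t" for j using fun_cong[OF e, of j] that by simp
      ultimately show "r = r' \<and> g = g'" by (metis ext)
    qed
    show "(\<lambda>(r, g). g(t := r)) ` ?X = injections (insert t S) R"
    proof (intro equalityI subsetI)
      fix h assume "h \<in> (\<lambda>(r, g). g(t := r)) ` ?X"
      then obtain r g where "r \<in> R" "g \<in> injections S (R - {r})" "h = g(t := r)" by auto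
      then show "h \<in> injections (insert t S) R"
        using assms(1) by (auto simp: injections_def inj_on_def PiE_iff extensional_def)
    next
      fix h assume h: "h \<in> injections (insert t S) R"
      have "h(t := undefined) \<in> injections S (R - {h t})"
        using h assms(1) by (auto simp: injections_def inj_on_def PiE_iff extensional_def)
      moreover have "h t \<in> R" using h by (auto simp: injections_def)
      ultimately show "h \<in> (\<lambda>(r, g). g(t := r)) ` ?X"
        by (intro image_eqI[of _ _ "(h t, h(t := undefined))"]) auto
    qed
  qed
  have "mat_sum a (insert t S) R = (\<Sum>(r, g)\<in>?X. \<Prod>j\<in>insert t S. a ((g(t := r)) j) j)"
    unfolding mat_sum_def sum.reindex_bij_betw[OF bij, symmetric] by (rule sum.cong) auto
  also have "\<dots> = (\<Sum>r\<in>R. \<Sum>g\<in>injections S (R - {r}). \<Prod>j\<in>insert t S. a ((g(t := r)) j) j)"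
    by (rule sum.Sigma[symmetric]) (use assms in auto)
  also have "\<dots> = (\<Sum>r\<in>R. a r t * mat_sum a S (R - {r}))"
    unfolding mat_sum_def sum_distrib_left
  proof (intro sum.cong refl)
    fix r g
    have "(\<Prod>j\<in>S. a ((g(t := r)) j) j) = (\<Prod>j\<in>S. a (g j) j)"
      using assms(1) by (intro prod.cong) auto
    then show "(\<Prod>j\<in>insert t S. a ((g(t := r)) j) j) = a r t * (\<Prod>j\<in>S. a (g j) j)"
      using assms by simp
  qed
  finally show ?thesis .
qed

text \<open>The capacity step: \<open>weighted_sum\<close> at \<open>b + \<tau> u\<close> is at most \<open>A\<^sub>0 exp (\<tau> A\<^sub>1 / A\<^sub>0)\<close>, where \<open>A\<^sub>0, A\<^sub>1\<close> are
  its first two coefficients as a polynomial in \<open>\<tau>\<close>; take \<open>\<tau> = A\<^sub>0 / A\<^sub>1\<close>.\<close>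

lemma capacity_step:
  assumes a: "\<And>i j. a i j > 0" and b: "\<And>i. b i > 0" and fin: "finite S" "finite R"
    and "t \<notin> S" "card S < card R"
  shows "\<exists>\<tau>>0. weighted_sum a S R (\<lambda>i. b i + \<tau> * a i t) \<le> exp 1 * \<tau> * weighted_sum a (insert t S) R b"
proof -
  define \<alpha> where "\<alpha> i j = a i j / b i" for i j
  have \<alpha>: "\<alpha> i j > 0" for i j using a b by (simp add: \<alpha>_def)
  let ?M = "mat_sum \<alpha>"
  define B where "B = (\<Prod>i\<in>R. b i)"
  have Bp: "B > 0" using b by (auto simp: B_def intro: prod_pos)
  have M0: "?M S R > 0" using mat_sum_pos[OF \<alpha> fin] assms by simp
  have M1: "?M (insert t S) R > 0" using mat_sum_pos[OF \<alpha>, of "insert t S" R] assms by simp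
  have M1e: "?M (insert t S) R = (\<Sum>r\<in>R. \<alpha> r t * ?M S (R - {r}))" using assms by (simp add: mat_sum_insert)
  define \<tau> where "\<tau> = ?M S R / ?M (insert t S) R"
  have \<tau>: "\<tau> > 0" using M0 M1 by (simp add: \<tau>_def)
  define c where "c i = \<tau> * \<alpha> i t" for i
  have c: "c i \<ge> 0" for i using \<tau> \<alpha>[of i t] by (simp add: c_def)
  define m where "m r = ?M S (R - {r}) / ?M S R" for r
  have m: "m r \<ge> 0" for r using M0 mat_sum_nonneg[of \<alpha> S "R - {r}"] \<alpha> by (simp add: m_def less_imp_le)
  have "weighted_sum a S R (\<lambda>i. b i + \<tau> * a i t) = weighted_sum a S R (\<lambda>i. b i * (1 + c i))"
    using b by (simp add: c_def \<alpha>_def distrib_left less_imp_neq[symmetric])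
  also have "\<dots> = B * weighted_sum \<alpha> S R (\<lambda>i. 1 + c i)"
    using weighted_sum_normalize[OF b fin] by (simp add: B_def \<alpha>_def[abs_def])
  also have "weighted_sum \<alpha> S R (\<lambda>i. 1 + c i) = (\<Sum>X\<in>Pow R. (\<Prod>i\<in>X. c i) * ?M S (R - X))"
    by (rule weighted_sum_expand[OF fin])
  also have "\<dots> \<le> (\<Sum>X\<in>Pow R. ?M S R * (\<Prod>i\<in>X. c i * m i))"
  proof (rule sum_mono)
    fix X assume "X \<in> Pow R"
    then have X: "finite X" using fin finite_subset by auto
    have "?M S (R - X) / ?M S R \<le> (\<Prod>r\<in>X. m r)"
      unfolding m_def using mat_sum_submultiplicative[OF _ fin X M0] \<alpha> by (simp add: less_imp_le)
    then have "?M S (R - X) \<le> ?M S R * (\<Prod>r\<in>X. m r)"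
      using M0 by (simp add: field_simps)
    then have "(\<Prod>i\<in>X. c i) * ?M S (R - X) \<le> (\<Prod>i\<in>X. c i) * (?M S R * (\<Prod>r\<in>X. m r))"
      by (intro mult_left_mono prod_nonneg) (auto simp: c)
    then show "(\<Prod>i\<in>X. c i) * ?M S (R - X) \<le> ?M S R * (\<Prod>i\<in>X. c i * m i)"
      by (simp add: prod.distrib mult_ac)
  qed
  also have "\<dots> = ?M S R * (\<Prod>i\<in>R. c i * m i + 1)"
    using prod_add[of R "\<lambda>i. c i * m i" "\<lambda>_. 1"] fin by (simp add: sum_distrib_left)
  also have "\<dots> \<le> ?M S R * (\<Prod>i\<in>R. exp (c i * m i))"
    using M0 c m by (intro mult_left_mono prod_mono) (auto simp: add.commute)
  also have "(\<Prod>i\<in>R. exp (c i * m i)) = exp (\<Sum>i\<in>R. c i * m i)"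
    using fin by (simp add: exp_sum)
  also have "(\<Sum>i\<in>R. c i * m i) = \<tau> / ?M S R * ?M (insert t S) R"
    unfolding M1e c_def m_def by (simp add: sum_distrib_left mult.assoc)
  also have "\<dots> = 1" using M0 M1 by (simp add: \<tau>_def)
  finally have "weighted_sum a S R (\<lambda>i. b i + \<tau> * a i t) \<le> B * (?M S R * exp 1)"
    using Bp by simp
  also have "\<dots> = exp 1 * \<tau> * (B * ?M (insert t S) R)" using M1 by (simp add: \<tau>_def)
  also have "B * ?M (insert t S) R = weighted_sum a (insert t S) R b"
    using weighted_sum_normalize[where b = b and S = "insert t S" and R = R and a = a and c = "\<lambda>_. 1", OF b] fin
    by (simp add: B_def \<alpha>_def[abs_def] weighted_sum_def mat_sum_def)
  finally show ?thesis using \<tau> by blast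
qed

section \<open>Capacity of matrices with constant line sums\<close>

lemma weighted_AM_GM:
  fixes w x :: "'a \<Rightarrow> real"
  assumes "finite C" "C \<noteq> {}" "\<And>j. j \<in> C \<Longrightarrow> w j \<ge> 0" "(\<Sum>j\<in>C. w j) = 1" "\<And>j. j \<in> C \<Longrightarrow> x j > 0"
  shows "(\<Prod>j\<in>C. x j powr w j) \<le> (\<Sum>j\<in>C. w j * x j)"
proof -
  have pos: "(\<Sum>j\<in>C. w j * x j) > 0"
  proof -
    obtain k where k: "k \<in> C" "w k > 0"
      using assms(3,4) by (metis less_eq_real_def sum.neutral zero_neq_one)
    show ?thesis
      by (rule sum_pos2[OF assms(1) k(1)]) (use k assms in \<open>auto intro!: mult_nonneg_nonneg simp: less_imp_le\<close>)
  qed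
  have "(\<Sum>j\<in>C. w j * ln (x j)) \<le> ln (\<Sum>j\<in>C. w j * x j)"
    using concave_on_sum[OF assms(1,2) ln_concave assms(4,3), of x] assms(5) by simp
  then have "exp (\<Sum>j\<in>C. w j * ln (x j)) \<le> (\<Sum>j\<in>C. w j * x j)"
    using pos by (metis exp_le_cancel_iff exp_ln)
  moreover have "exp (\<Sum>j\<in>C. w j * ln (x j)) = (\<Prod>j\<in>C. x j powr w j)"
    unfolding exp_sum[OF assms(1)] using assms(5) by (intro prod.cong) (auto simp: powr_def less_imp_neq[symmetric])
  ultimately show ?thesis by simp
qed

text \<open>Gurvits's induction. For \<open>S = {}\<close>, weighted AM-GM with weights
  \<open>a i j / d\<close> bounds each row form from below, and the column sums make the total
  exponent of every x j equal to 1. Each further column is eliminated by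
  \<open>capacity_step\<close> at the price of a factor e. \<open>S\<close> stays a proper subset of
  \<open>C\<close> so that the remaining row forms are positive.\<close>

lemma capacity_bound:
  fixes a :: "'a \<Rightarrow> 'b \<Rightarrow> real"
  assumes a: "\<And>i j. a i j > 0" and fin: "finite R" "finite C" and card: "card R = card C"
    and rows: "\<And>i. i \<in> R \<Longrightarrow> (\<Sum>j\<in>C. a i j) = d" and cols: "\<And>j. j \<in> C \<Longrightarrow> (\<Sum>i\<in>R. a i j) = d" and "d > 0"
    and "finite S" "S \<subset> C" and x: "\<And>j. x j > 0"
  shows "d ^ card C / exp 1 ^ card S * (\<Prod>j\<in>C - S. x j)
    \<le> weighted_sum a S R (\<lambda>i. \<Sum>j\<in>C - S. a i j * x j)"
  using assms(8-)
proof (induction S arbitrary: x)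
  case empty
  have Cne: "C \<noteq> {}" using empty by auto
  have p: "(\<Prod>j\<in>C. x j powr (a i j / d)) * d \<le> (\<Sum>j\<in>C. a i j * x j)" if i: "i \<in> R" for i
  proof -
    have "(\<Prod>j\<in>C. x j powr (a i j / d)) \<le> (\<Sum>j\<in>C. (a i j / d) * x j)"
      using fin Cne a \<open>d > 0\<close> rows[OF i] empty(2)
      by (intro weighted_AM_GM) (auto simp: sum_divide_distrib[symmetric] less_imp_le)
    then show ?thesis using \<open>d > 0\<close> by (simp add: sum_divide_distrib[symmetric] field_simps)
  qed
  have "(\<Prod>j\<in>C. x j) = (\<Prod>j\<in>C. \<Prod>i\<in>R. x j powr (a i j / d))"
  proof (rule prod.cong[OF refl])
    fix j assume "j \<in> C"
    have "(\<Prod>i\<in>R. x j powr (a i j / d)) = x j powr (\<Sum>i\<in>R. a i j / d)"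
      using empty(2)[of j] by (intro powr_sum[symmetric]) (auto simp: fin)
    also have "(\<Sum>i\<in>R. a i j / d) = 1" using cols[OF \<open>j \<in> C\<close>] \<open>d > 0\<close> by (simp add: sum_divide_distrib[symmetric])
    finally show "x j = (\<Prod>i\<in>R. x j powr (a i j / d))" using empty(2)[of j] by simp
  qed
  also have "\<dots> = (\<Prod>i\<in>R. \<Prod>j\<in>C. x j powr (a i j / d))" by (rule prod.swap)
  finally have "d ^ card C * (\<Prod>j\<in>C. x j) = (\<Prod>i\<in>R. (\<Prod>j\<in>C. x j powr (a i j / d)) * d)"
    by (simp add: prod.distrib card)
  also have "\<dots> \<le> (\<Prod>i\<in>R. \<Sum>j\<in>C. a i j * x j)"
    using p \<open>d > 0\<close> by (intro prod_mono) (auto intro!: mult_nonneg_nonneg prod_nonneg)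
  also have "\<dots> = weighted_sum a {} R (\<lambda>i. \<Sum>j\<in>C - {}. a i j * x j)"
    by (simp add: weighted_sum_def injections_def)
  finally show ?case by simp
next
  case (insert t S)
  have t: "t \<in> C" "S \<subset> C" using insert by auto
  define b where "b i = (\<Sum>j\<in>C - insert t S. a i j * x j)" for i
  have b: "b i > 0" for i
    unfolding b_def using insert a fin by (intro sum_pos) auto
  have "card S < card R" using t card fin psubset_card_mono by metis
  then obtain \<tau> where \<tau>: "\<tau> > 0"
    "weighted_sum a S R (\<lambda>i. b i + \<tau> * a i t) \<le> exp 1 * \<tau> * weighted_sum a (insert t S) R b"
    using capacity_step[where a = a and b = b, OF a b insert(1) fin(1) insert(2)] by blast
  have e: "C - S = insert t (C - insert t S)" using t insert(2) by auto
  \<comment> \<open>The induction hypothesis holds at every positive point. It is used where the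
    variable of \<open>t\<close> equals the \<tau> of \<open>capacity_step\<close>, so that \<tau>
    cancels in the end.\<close>
  have "d ^ card C / exp 1 ^ card S * (\<Prod>j\<in>C - S. (x(t := \<tau>)) j)
      \<le> weighted_sum a S R (\<lambda>i. \<Sum>j\<in>C - S. a i j * (x(t := \<tau>)) j)"
    using insert.IH[of "x(t := \<tau>)"] t insert.prems \<tau> by auto
  also have "(\<Prod>j\<in>C - S. (x(t := \<tau>)) j) = \<tau> * (\<Prod>j\<in>C - insert t S. x j)"
  proof -
    have "(\<Prod>j\<in>C - insert t S. (x(t := \<tau>)) j) = (\<Prod>j\<in>C - insert t S. x j)" by (rule prod.cong) auto
    then show ?thesis unfolding e using fin by simp
  qed
  also have "(\<lambda>i. \<Sum>j\<in>C - S. a i j * (x(t := \<tau>)) j) = (\<lambda>i. b i + \<tau> * a i t)"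
  proof
    fix i
    have "(\<Sum>j\<in>C - insert t S. a i j * (x(t := \<tau>)) j) = b i" unfolding b_def by (rule sum.cong) auto
    then show "(\<Sum>j\<in>C - S. a i j * (x(t := \<tau>)) j) = b i + \<tau> * a i t" unfolding e using fin by simp
  qed
  also note \<tau>(2)
  finally have "\<tau> * (d ^ card C / exp 1 ^ card S * (\<Prod>j\<in>C - insert t S. x j))
      \<le> \<tau> * (exp 1 * weighted_sum a (insert t S) R b)" by (simp add: mult_ac)
  then have "d ^ card C / exp 1 ^ card S * (\<Prod>j\<in>C - insert t S. x j) \<le> exp 1 * weighted_sum a (insert t S) R b"
    using \<tau>(1) by (rule mult_left_le_imp_le)
  then show ?case using insert(1,2) unfolding b_def by (simp add: field_simps)
qed

text \<open>With one column left, an injection of the others misses exactly one row, so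
  \<open>weighted_sum\<close> is the permanent expanded along that column. Only card C - 1 factors e
  have been paid; one more is given away for a uniform bound.\<close>

lemma permanent_lower_bound_pos:
  fixes a :: "'a \<Rightarrow> 'b \<Rightarrow> real"
  assumes a: "\<And>i j. a i j > 0" and fin: "finite R" "finite C" and card: "card R = card C"
    and rows: "\<And>i. i \<in> R \<Longrightarrow> (\<Sum>j\<in>C. a i j) = d" and cols: "\<And>j. j \<in> C \<Longrightarrow> (\<Sum>i\<in>R. a i j) = d" and "d > 0"
  shows "(d / exp 1) ^ card C \<le> mat_sum a C R"
proof (cases "C = {}")
  case True
  then show ?thesis by (simp add: mat_sum_def injections_def)
next
  case False
  then obtain t where t: "t \<in> C" by auto
  define S where "S = C - {t}"
  have S: "finite S" "S \<subset> C" "C = insert t S" "t \<notin> S" "C - S = {t}" using t fin by (auto simp: S_def)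
  have "d ^ card C / exp 1 ^ card S \<le> weighted_sum a S R (\<lambda>i. a i t)"
    using capacity_bound[OF a fin card rows cols \<open>d > 0\<close> S(1,2), of "\<lambda>_. 1"] S by simp
  also have "\<dots> = (\<Sum>g\<in>injections S R. \<Sum>r\<in>R - g ` S. a r t * (\<Prod>j\<in>S. a (g j) j))"
    unfolding weighted_sum_def
  proof (rule sum.cong[OF refl])
    fix g assume g: "g \<in> injections S R"
    have "card (R - g ` S) = 1"
      using injections_image[OF g] fin S card by (simp add: card_Diff_subset card_image)
    then obtain r where "R - g ` S = {r}" by (metis card_1_singletonE)
    then show "(\<Prod>j\<in>S. a (g j) j) * (\<Prod>i\<in>R - g ` S. a i t) = (\<Sum>r\<in>R - g ` S. a r t * (\<Prod>j\<in>S. a (g j) j))"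
      by simp
  qed
  also have "\<dots> = (\<Sum>g\<in>injections S R. \<Sum>r | r \<in> R \<and> r \<notin> g ` S. a r t * (\<Prod>j\<in>S. a (g j) j))"
    by (intro sum.cong) auto
  also have "\<dots> = (\<Sum>r\<in>R. \<Sum>g | g \<in> injections S R \<and> r \<notin> g ` S. a r t * (\<Prod>j\<in>S. a (g j) j))"
    by (rule sum.swap_restrict) (use fin S in auto)
  also have "\<dots> = (\<Sum>r\<in>R. a r t * mat_sum a S (R - {r}))"
    by (intro sum.cong refl) (auto simp: mat_sum_def injections_Diff sum_distrib_left)
  also have "\<dots> = mat_sum a C R" unfolding S(3) by (rule mat_sum_insert[symmetric]) (use fin S in auto)
  finally have "d ^ card C / exp 1 ^ card S \<le> mat_sum a C R" .
  moreover have "(d / exp 1) ^ card C \<le> d ^ card C / exp 1 ^ card S"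
    using S \<open>d > 0\<close> unfolding power_divide
    by (intro divide_left_mono power_increasing) (auto intro: card_mono fin)
  ultimately show ?thesis by linarith
qed

text \<open>Adding \<delta> to every entry makes the matrix positive and keeps all row and column
  sums equal; then \<delta> tends to 0.\<close>

lemma permanent_lower_bound:
  fixes a :: "'a \<Rightarrow> 'b \<Rightarrow> real"
  assumes a: "\<And>i j. a i j \<ge> 0" and fin: "finite R" "finite C" and card: "card R = card C"
    and rows: "\<And>i. i \<in> R \<Longrightarrow> (\<Sum>j\<in>C. a i j) = d" and cols: "\<And>j. j \<in> C \<Longrightarrow> (\<Sum>i\<in>R. a i j) = d" and "d > 0"
  shows "(d / exp 1) ^ card C \<le> mat_sum a C R"
proof -
  have ev: "(d / exp 1) ^ card C \<le> mat_sum (\<lambda>i j. a i j + \<delta>) C R" if "\<delta> > 0" for \<delta>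
  proof -
    have "(d / exp 1) ^ card C \<le> ((d + card C * \<delta>) / exp 1) ^ card C"
      using \<open>d > 0\<close> that by (intro power_mono divide_right_mono) auto
    also have "\<dots> \<le> mat_sum (\<lambda>i j. a i j + \<delta>) C R"
      by (rule permanent_lower_bound_pos)
        (use a that fin card rows cols \<open>d > 0\<close> in \<open>auto simp: sum.distrib add_nonneg_pos add_pos_nonneg\<close>)
    finally show ?thesis .
  qed
  have "((\<lambda>\<delta>. mat_sum (\<lambda>i j. a i j + \<delta>) C R) \<longlongrightarrow> mat_sum (\<lambda>i j. a i j + 0) C R) (at_right 0)"
    unfolding mat_sum_def by (intro tendsto_intros)
  moreover have "eventually (\<lambda>\<delta>. (d / exp 1) ^ card C \<le> mat_sum (\<lambda>i j. a i j + \<delta>) C R) (at_right 0)"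
    by (rule eventually_mono[OF eventually_at_right_less]) (rule ev)
  ultimately have "(d / exp 1) ^ card C \<le> mat_sum (\<lambda>i j. a i j + 0) C R"
    by (rule tendsto_lowerbound) simp
  then show ?thesis by simp
qed

section \<open>Counting Latin squares\<close>

definition latin_rectangles :: "nat \<Rightarrow> nat \<Rightarrow> entry set set" where
  "latin_rectangles n k = {L. partial_latin_square n L \<and> rows_of L \<subseteq> {1..k} \<and>
     (\<forall>r\<in>{1..k}. \<forall>c\<in>{1..n}. \<exists>s. (r, c, s) \<in> L)}"

lemma finite_latin_rectangles [simp]: "finite (latin_rectangles n k)"
  by (rule finite_subset[of _ "Pow ({1..n} \<times> {1..n} \<times> {1..n})"])
     (auto simp: latin_rectangles_def partial_latin_square_def)

lemma latin_rectangles_full: "latin_rectangles n n = {L. latin_square n L}"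
  by (auto simp: latin_rectangles_def latin_square_def partial_latin_square_def rows_of_def)

lemma partial_latin_squareD:
  assumes "partial_latin_square n L"
  shows "(r, c, s) \<in> L \<Longrightarrow> r \<in> {1..n} \<and> c \<in> {1..n} \<and> s \<in> {1..n}"
    "(r, c, s) \<in> L \<Longrightarrow> (r, c, s') \<in> L \<Longrightarrow> s = s'"
    "(r, c, s) \<in> L \<Longrightarrow> (r, c', s) \<in> L \<Longrightarrow> c = c'"
    "(r, c, s) \<in> L \<Longrightarrow> (r', c, s) \<in> L \<Longrightarrow> r = r'"
proof -
  note p = assms[unfolded partial_latin_square_def]
  show "(r, c, s) \<in> L \<Longrightarrow> r \<in> {1..n} \<and> c \<in> {1..n} \<and> s \<in> {1..n}" using conjunct1[OF p] by blast
  show "(r, c, s) \<in> L \<Longrightarrow> (r, c, s') \<in> L \<Longrightarrow> s = s'" using conjunct1[OF conjunct2[OF p]] by blast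
  show "(r, c, s) \<in> L \<Longrightarrow> (r, c', s) \<in> L \<Longrightarrow> c = c'" using conjunct1[OF conjunct2[OF conjunct2[OF p]]] by blast
  show "(r, c, s) \<in> L \<Longrightarrow> (r', c, s) \<in> L \<Longrightarrow> r = r'" using conjunct2[OF conjunct2[OF conjunct2[OF p]]] by blast
qed

lemma latin_rectangle_function:
  assumes "L \<in> latin_rectangles n k"
  obtains f where "\<And>r c s. (r, c, s) \<in> L \<longleftrightarrow> r \<in> {1..k} \<and> c \<in> {1..n} \<and> s = f r c"
    "\<And>r. r \<in> {1..k} \<Longrightarrow> bij_betw (f r) {1..n} {1..n}" "\<And>c. c \<in> {1..n} \<Longrightarrow> inj_on (\<lambda>r. f r c) {1..k}"
proof -
  define f where "f r c = (SOME s. (r, c, s) \<in> L)" for r c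
  have pl: "partial_latin_square n L" and Lr: "rows_of L \<subseteq> {1..k}"
    and Lf: "\<forall>r\<in>{1..k}. \<forall>c\<in>{1..n}. \<exists>s. (r, c, s) \<in> L"
    using assms by (simp_all add: latin_rectangles_def)
  note L = partial_latin_squareD[OF pl]
  have f: "(r, c, f r c) \<in> L" if "r \<in> {1..k}" "c \<in> {1..n}" for r c
    unfolding f_def using Lf that by (metis someI_ex)
  have 1: "(r, c, s) \<in> L \<longleftrightarrow> r \<in> {1..k} \<and> c \<in> {1..n} \<and> s = f r c" for r c s
  proof
    assume a: "(r, c, s) \<in> L"
    have "r \<in> {1..k}" using a Lr unfolding rows_of_def by blast
    moreover have "c \<in> {1..n}" using L(1)[OF a] by simp
    ultimately show "r \<in> {1..k} \<and> c \<in> {1..n} \<and> s = f r c" using f L(2)[OF a] by blast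
  qed (use f in auto)
  have 2: "bij_betw (f r) {1..n} {1..n}" if r: "r \<in> {1..k}" for r
  proof -
    have "inj_on (f r) {1..n}"
    proof (rule inj_onI)
      fix x y assume "x \<in> {1..n}" "y \<in> {1..n}" "f r x = f r y"
      then show "x = y" using L(3)[OF f[OF r, of x], of y] f[OF r, of y] by simp
    qed
    moreover have "f r ` {1..n} \<subseteq> {1..n}"
      using L(1)[OF f[OF r]] by blast
    ultimately show ?thesis
      by (simp add: bij_betw_def endo_inj_surj)
  qed
  have 3: "inj_on (\<lambda>r. f r c) {1..k}" if c: "c \<in> {1..n}" for c
  proof (rule inj_onI)
    fix x y assume "x \<in> {1..k}" "y \<in> {1..k}" "f x c = f y c"
    then show "x = y" using L(4)[OF f[OF _ c, of x], of y] f[OF _ c, of y] by simp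
  qed
  show thesis by (rule that[OF 1 2 3])
qed

text \<open>The possible next rows are the perfect matchings of the graph of symbols and columns in
  which a symbol is joined to the columns where it has not occurred. Each column has seen k symbols
  and each symbol occupies k columns, so this graph is regular of degree n - k.\<close>

lemma latin_rectangle_extensions:
  assumes L: "L \<in> latin_rectangles n k" and "k < n"
  shows "((real n - real k) / exp 1) ^ n
    \<le> card {g \<in> injections {1..n} {1..n}. \<forall>c\<in>{1..n}. \<forall>r. (r, c, g c) \<notin> L}"
proof -
  obtain f where f: "\<And>r c s. (r, c, s) \<in> L \<longleftrightarrow> r \<in> {1..k} \<and> c \<in> {1..n} \<and> s = f r c"
    and bij: "\<And>r. r \<in> {1..k} \<Longrightarrow> bij_betw (f r) {1..n} {1..n}"
    and inj: "\<And>c. c \<in> {1..n} \<Longrightarrow> inj_on (\<lambda>r. f r c) {1..k}"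
    using latin_rectangle_function[OF L] by blast
  define a :: "nat \<Rightarrow> nat \<Rightarrow> real" where "a s c = (if \<exists>r. (r, c, s) \<in> L then 0 else 1)" for s c
  have sum_a: "(\<Sum>x\<in>{1..n}. if Q x then 0 else 1 :: real) = real n - real (card {x \<in> {1..n}. Q x})" for Q :: "nat \<Rightarrow> bool"
  proof -
    have "(\<Sum>x\<in>{1..n}. if Q x then 0 else 1 :: real) = (\<Sum>x\<in>{1..n}. 1 - (if Q x then 1 else 0))"
      by (intro sum.cong) auto
    also have "\<dots> = real n - real (card {x \<in> {1..n}. Q x})"
      by (simp add: sum_subtractf sum.If_cases Int_def)
    finally show ?thesis .
  qed
  have cols: "(\<Sum>s\<in>{1..n}. a s c) = real n - real k" if c: "c \<in> {1..n}" for c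
  proof -
    have "{s \<in> {1..n}. \<exists>r. (r, c, s) \<in> L} = (\<lambda>r. f r c) ` {1..k}"
    proof -
      have "f r c \<in> {1..n}" if "r \<in> {1..k}" for r
        using bij_betwE[OF bij[OF that]] c by blast
      then show ?thesis using c unfolding f by blast
    qed
    then show ?thesis unfolding a_def sum_a using card_image[OF inj[OF c]] by simp
  qed
  have rows: "(\<Sum>c\<in>{1..n}. a s c) = real n - real k" if s: "s \<in> {1..n}" for s
  proof -
    \<comment> \<open>The column in which row \<open>r\<close> contains the symbol
      \<open>s\<close>.\<close>
    define h where "h r = inv_into {1..n} (f r) s" for r
    have h: "h r \<in> {1..n}" "f r (h r) = s" if "r \<in> {1..k}" for r
      using bij[OF that] s unfolding h_def bij_betw_def
      by (metis inv_into_into, metis f_inv_into_f)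
    have hu: "c = h r" if "r \<in> {1..k}" "c \<in> {1..n}" "f r c = s" for r c
      using bij[OF that(1)] that h[OF that(1)] by (metis bij_betw_def inj_onD)
    have "{c \<in> {1..n}. \<exists>r. (r, c, s) \<in> L} = h ` {1..k}"
    proof (intro equalityI subsetI)
      fix c assume "c \<in> {c \<in> {1..n}. \<exists>r. (r, c, s) \<in> L}"
      then obtain r where "c \<in> {1..n}" "r \<in> {1..k}" "s = f r c" unfolding f by blast
      then show "c \<in> h ` {1..k}" using hu by blast
    next
      fix c assume "c \<in> h ` {1..k}"
      then show "c \<in> {c \<in> {1..n}. \<exists>r. (r, c, s) \<in> L}" unfolding f using h by blast
    qed
    moreover have "inj_on h {1..k}"
    proof (rule inj_onI)
      fix r r' assume r: "r \<in> {1..k}" "r' \<in> {1..k}" "h r = h r'"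
      then show "r = r'" using h[OF r(1)] h[OF r(2)] inj[OF h(1)[OF r(1)]] by (auto dest: inj_onD)
    qed
    ultimately show ?thesis unfolding a_def sum_a using card_image[of h "{1..k}"] by simp
  qed
  have "((real n - real k) / exp 1) ^ card {1..n} \<le> mat_sum a {1..n} {1..n}"
    by (rule permanent_lower_bound) (use rows cols \<open>k < n\<close> in \<open>auto simp: a_def\<close>)
  also have "\<dots> = (\<Sum>g\<in>injections {1..n} {1..n}. if \<forall>c\<in>{1..n}. \<forall>r. (r, c, g c) \<notin> L then 1 else 0)"
    unfolding mat_sum_def
  proof (rule sum.cong[OF refl])
    fix g
    show "(\<Prod>j\<in>{1..n}. a (g j) j) = (if \<forall>c\<in>{1..n}. \<forall>r. (r, c, g c) \<notin> L then 1 else 0)"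
    proof (cases "\<forall>c\<in>{1..n}. \<forall>r. (r, c, g c) \<notin> L")
      case True
      then have "(\<Prod>j\<in>{1..n}. a (g j) j) = (\<Prod>j\<in>{1..n}. 1)" by (intro prod.cong) (auto simp: a_def)
      then show ?thesis using True by simp
    next
      case False
      then obtain c where "c \<in> {1..n}" "\<exists>r. (r, c, g c) \<in> L" by blast
      then have "c \<in> {1..n}" "a (g c) c = 0" by (auto simp: a_def)
      then have "(\<Prod>j\<in>{1..n}. a (g j) j) = 0" by (intro prod_zero) auto
      then show ?thesis using False by auto
    qed
  qed
  also have "\<dots> = card {g \<in> injections {1..n} {1..n}. \<forall>c\<in>{1..n}. \<forall>r. (r, c, g c) \<notin> L}"
    by (subst sum.inter_filter[symmetric]) auto
  finally show ?thesis by simp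
qed

lemma card_latin_rectangles_Suc:
  assumes "k < n"
  shows "card (latin_rectangles n k) * ((real n - real k) / exp 1) ^ n \<le> card (latin_rectangles n (Suc k))"
proof -
  define G where "G L = {g \<in> injections {1..n} {1..n}. \<forall>c\<in>{1..n}. \<forall>r. (r, c, g c) \<notin> L}" for L :: "entry set"
  define ext where "ext = (\<lambda>(L :: entry set, g). L \<union> {(Suc k, c, g c) | c. c \<in> {1..n}})"
  let ?X = "SIGMA L:latin_rectangles n k. G L"
  have fin: "finite (G L)" for L by (simp add: G_def)
  have row: "(Suc k, c, s) \<notin> L" if "L \<in> latin_rectangles n k" for c s L
    proof
    assume "(Suc k, c, s) \<in> L"
    then have "Suc k \<in> rows_of L" unfolding rows_of_def by blast
    then show False using that by (auto simp: latin_rectangles_def)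
  qed
  have sub: "ext ` ?X \<subseteq> latin_rectangles n (Suc k)"
  proof
    fix y assume "y \<in> ext ` ?X"
    then obtain L g where L: "L \<in> latin_rectangles n k" and g: "g \<in> G L" and y: "y = ext (L, g)" by auto
    have gi: "inj_on g {1..n}" "\<And>c. c \<in> {1..n} \<Longrightarrow> g c \<in> {1..n}" "\<And>c r. c \<in> {1..n} \<Longrightarrow> (r, c, g c) \<notin> L"
      using g by (auto simp: G_def injections_def)
    have mem: "(r, c, s) \<in> y \<longleftrightarrow> (r, c, s) \<in> L \<or> r = Suc k \<and> c \<in> {1..n} \<and> s = g c" for r c s
      by (auto simp: y ext_def)
    have Lp: "partial_latin_square n L" and Lr: "rows_of L \<subseteq> {1..k}"
      and Lf: "\<And>r c. r \<in> {1..k} \<Longrightarrow> c \<in> {1..n} \<Longrightarrow> \<exists>s. (r, c, s) \<in> L"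
      using L by (simp_all add: latin_rectangles_def)
    note pD = partial_latin_squareD[OF Lp]
    have "partial_latin_square n y"
      unfolding partial_latin_square_def
    proof (intro conjI allI impI)
      show "y \<subseteq> {1..n} \<times> {1..n} \<times> {1..n}"
        using pD(1) gi(2) assms by (fastforce simp: y ext_def)
      show "s = s'" if "(r, c, s) \<in> y \<and> (r, c, s') \<in> y" for r c s s'
        using that row[OF L] pD(2) unfolding mem by blast
      show "c = c'" if "(r, c, s) \<in> y \<and> (r, c', s) \<in> y" for r c c' s
        using that row[OF L] pD(3)[of r c s c'] inj_onD[OF gi(1), of c c'] unfolding mem by auto
      show "r = r'" if "(r, c, s) \<in> y \<and> (r', c, s) \<in> y" for r r' c s
        using that row[OF L] pD(4)[of r c s r'] gi(3) unfolding mem by blast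
    qed
    moreover have "rows_of y \<subseteq> {1..Suc k}"
    proof
      fix r assume "r \<in> rows_of y"
      then have "r \<in> rows_of L \<or> r = Suc k" unfolding rows_of_def mem by blast
      then show "r \<in> {1..Suc k}" using Lr by auto
    qed
    moreover have "\<exists>s. (r, c, s) \<in> y" if "r \<in> {1..Suc k}" "c \<in> {1..n}" for r c
      using that Lf[of r c] by (cases "r = Suc k") (auto simp: mem)
    ultimately show "y \<in> latin_rectangles n (Suc k)" by (simp add: latin_rectangles_def)
  qed
  have inj: "inj_on ext ?X"
  proof (rule inj_onI, clarsimp)
    fix L g L' g'
    assume L: "L \<in> latin_rectangles n k" "L' \<in> latin_rectangles n k" and g: "g \<in> G L" "g' \<in> G L'"
      and e: "ext (L, g) = ext (L', g')"
    have "L = {x \<in> ext (L, g). fst x \<noteq> Suc k}" "L' = {x \<in> ext (L', g'). fst x \<noteq> Suc k}"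
      using row[OF L(1)] row[OF L(2)] by (auto simp: ext_def)
    then have LL: "L = L'" using e by simp
    have "g c = g' c" if "c \<in> {1..n}" for c
    proof -
      have "(Suc k, c, g c) \<in> ext (L', g')" unfolding e[symmetric] using that by (auto simp: ext_def)
      then show ?thesis using row[OF L(2)] by (auto simp: ext_def)
    qed
    moreover have "g \<in> extensional {1..n}" "g' \<in> extensional {1..n}"
      using g by (auto simp: G_def injections_def PiE_def)
    ultimately show "L = L' \<and> g = g'" using LL extensionalityI by blast
  qed
  have "card (latin_rectangles n k) * ((real n - real k) / exp 1) ^ n
      = (\<Sum>L\<in>latin_rectangles n k. ((real n - real k) / exp 1) ^ n)" by simp
  also have "\<dots> \<le> (\<Sum>L\<in>latin_rectangles n k. real (card (G L)))"
    unfolding G_def by (intro sum_mono latin_rectangle_extensions assms)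
  also have "\<dots> = real (card ?X)" using fin by simp
  also have "card ?X = card (ext ` ?X)" by (simp add: card_image[OF inj])
  also have "\<dots> \<le> card (latin_rectangles n (Suc k))" by (intro card_mono sub) simp
  finally show ?thesis by simp
qed

lemma card_latin_rectangles_ge:
  "k \<le> n \<Longrightarrow> (\<Prod>i<k. ((real n - real i) / exp 1) ^ n) \<le> card (latin_rectangles n k)"
proof (induction k)
  case 0
  have "{} \<in> latin_rectangles n 0"
    by (auto simp: latin_rectangles_def partial_latin_square_def rows_of_def)
  then have "card (latin_rectangles n 0) > 0" by (auto simp: card_gt_0_iff)
  then show ?case by (simp add: Suc_le_eq)
next
  case (Suc k)
  have "(\<Prod>i<Suc k. ((real n - real i) / exp 1) ^ n)
      \<le> card (latin_rectangles n k) * ((real n - real k) / exp 1) ^ n"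
    unfolding prod.lessThan_Suc using Suc by (intro mult_right_mono) auto
  also have "\<dots> \<le> card (latin_rectangles n (Suc k))" using Suc by (intro card_latin_rectangles_Suc) auto
  finally show ?case .
qed

lemma fact_ge_power: "(real n / exp 1) ^ n \<le> fact n"
proof -
  have s: "(\<lambda>k. real n ^ k / fact k) sums exp (real n)"
    using exp_converges[of "real n"] by (simp add: divide_inverse mult.commute)
  \<comment> \<open>Of the exponential series at n only the term k = n is kept.\<close>
  have "(\<Sum>k\<in>{n}. real n ^ k / fact k) \<le> (\<Sum>k. real n ^ k / fact k)"
    using s by (intro sum_le_suminf) (auto simp: sums_iff)
  then have "real n ^ n / fact n \<le> exp (real n)" using s by (simp add: sums_iff)
  moreover have "exp (real n) = exp 1 ^ n" by (simp add: exp_of_nat_mult[symmetric])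
  ultimately show ?thesis by (simp add: field_simps power_divide)
qed

text \<open>Each cell loses one factor e to the permanent bound and a second one to
  \<open>fact_ge_power\<close>.\<close>

lemma card_latin_squares_ge: "(real n / exp 2) ^ (n * n) \<le> card {L. latin_square n L}"
proof -
  have "(\<Prod>i<n. real n - real i) = fact n"
  proof -
    have "(\<Prod>i<n. real n - real i) = (\<Prod>i<n. real (Suc (n - Suc i)))"
      by (intro prod.cong) (auto simp: of_nat_diff)
    also have "\<dots> = (\<Prod>i<n. real (Suc i))" by (rule prod.nat_diff_reindex)
    also have "\<dots> = fact n" by (simp add: fact_prod_Suc atLeast0LessThan)
    finally show ?thesis .
  qed
  then have "(\<Prod>i<n. ((real n - real i) / exp 1) ^ n) = (fact n / exp 1 ^ n) ^ n"
    by (simp add: prod_power_distrib[symmetric] prod_dividef)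
  moreover have "((real n / exp 1) ^ n / exp 1 ^ n) ^ n \<le> (fact n / exp 1 ^ n) ^ n"
    by (intro power_mono divide_right_mono fact_ge_power) auto
  moreover have "((real n / exp 1) ^ n / exp 1 ^ n) ^ n = (real n / exp 2) ^ (n * n)"
    by (simp add: power_divide power_mult power_mult_distrib[symmetric] exp_add[symmetric])
  ultimately show ?thesis
    using card_latin_rectangles_ge[of n n] by (simp add: latin_rectangles_full)
qed

section \<open>Embeddings of sparse partial Latin squares\<close>

definition coord :: "nat \<Rightarrow> entry \<Rightarrow> nat" where
  "coord i = (\<lambda>(r, c, s). if i = 0 then r else if i = 1 then c else s)"

text \<open>A line is a pair \<open>(i, x)\<close>: row, column or symbol \<open>x\<close> according to \<open>i = 0, 1, 2\<close>. A map of
  lines preserves the type \<open>i\<close>, so it only needs to return the new index.\<close>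

definition lines_of :: "entry set \<Rightarrow> (nat \<times> nat) set" where
  "lines_of P = (\<Union>e\<in>P. (\<lambda>i. (i, coord i e)) ` {..<3})"

definition map_entry :: "(nat \<times> nat \<Rightarrow> nat) \<Rightarrow> entry \<Rightarrow> entry" where
  "map_entry \<phi> = (\<lambda>(r, c, s). (\<phi> (0, r), \<phi> (1, c), \<phi> (2, s)))"

text \<open>\<open>V\<close> may contain lines that do not lie on any entry of \<open>P\<close>.\<close>

definition homs :: "nat \<Rightarrow> entry set \<Rightarrow> (nat \<times> nat) set \<Rightarrow> entry set \<Rightarrow> (nat \<times> nat \<Rightarrow> nat) set" where
  "homs n Q V P = {\<phi> \<in> V \<rightarrow>\<^sub>E {1..n}. map_entry \<phi> ` P \<subseteq> Q}"

definition embs :: "nat \<Rightarrow> entry set \<Rightarrow> (nat \<times> nat) set \<Rightarrow> entry set \<Rightarrow> (nat \<times> nat \<Rightarrow> nat) set" where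
  "embs n Q V P = {\<phi> \<in> homs n Q V P. \<forall>l\<in>V. \<forall>l'\<in>V. fst l = fst l' \<and> \<phi> l = \<phi> l' \<longrightarrow> l = l'}"

text \<open>The condition (v - e) / e > 1 / 2 on every non-empty part, cleared of
  denominators.\<close>

definition sparse_entries :: "entry set \<Rightarrow> bool" where
  "sparse_entries P \<longleftrightarrow> (\<forall>F\<subseteq>P. F \<noteq> {} \<longrightarrow> 3 * card F < 2 * card (lines_of F))"

lemma less_3_cases: "i < 3 \<longleftrightarrow> i = 0 \<or> i = 1 \<or> i = (2::nat)"
  by auto

lemma finite_lines_of [simp]: "finite P \<Longrightarrow> finite (lines_of P)"
  by (simp add: lines_of_def)

lemma lines_of_mono: "P \<subseteq> P' \<Longrightarrow> lines_of P \<subseteq> lines_of P'"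
  by (auto simp: lines_of_def)

lemma mem_lines_of: "(i, x) \<in> lines_of P \<longleftrightarrow> i < 3 \<and> (\<exists>e\<in>P. x = coord i e)"
  by (auto simp: lines_of_def)

lemma lines_ofI: "e \<in> P \<Longrightarrow> i < 3 \<Longrightarrow> (i, coord i e) \<in> lines_of P"
  by (auto simp: mem_lines_of)

lemma card_lines_of:
  assumes "finite P"
  shows "card (lines_of P) = card (coord 0 ` P) + card (coord 1 ` P) + card (coord 2 ` P)"
proof -
  have "lines_of P = (SIGMA i:{..<3}. coord i ` P)"
    by (auto simp: lines_of_def)
  then show ?thesis using assms by (simp add: eval_nat_numeral)
qed

lemma coord_map_entry: "i < 3 \<Longrightarrow> coord i (map_entry \<phi> e) = \<phi> (i, coord i e)"
  by (auto simp: less_3_cases coord_def map_entry_def split: prod.splits)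

lemma entry_eqI: "(\<And>i. i < 3 \<Longrightarrow> coord i e = coord i e') \<Longrightarrow> e = e'"
proof -
  assume a: "\<And>i. i < 3 \<Longrightarrow> coord i e = coord i e'"
  show "e = e'" using a[of 0] a[of 1] a[of 2] by (auto simp: coord_def split: prod.splits)
qed

text \<open>The three uniqueness conditions in a form uniform in the type \<open>i\<close>, so that
  arguments about a forced line need no case split.\<close>

lemma partial_latin_square_unique:
  assumes "partial_latin_square n Q" "e \<in> Q" "e' \<in> Q" "i < 3" "\<And>j. j < 3 \<Longrightarrow> j \<noteq> i \<Longrightarrow> coord j e = coord j e'"
  shows "e = e'"
proof -
  obtain r c s where e: "e = (r, c, s)" by (metis prod_cases3)
  obtain r' c' s' where e': "e' = (r', c', s')" by (metis prod_cases3)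
  have u: "\<forall>r c s s'. (r, c, s) \<in> Q \<and> (r, c, s') \<in> Q \<longrightarrow> s = s'"
    "\<forall>r c c' s. (r, c, s) \<in> Q \<and> (r, c', s) \<in> Q \<longrightarrow> c = c'"
    "\<forall>r r' c s. (r, c, s) \<in> Q \<and> (r', c, s) \<in> Q \<longrightarrow> r = r'"
    using assms(1) unfolding partial_latin_square_def by blast+
  consider "i = 0" "c = c'" "s = s'" | "i = 1" "r = r'" "s = s'" | "i = 2" "r = r'" "c = c'"
    using assms(4) assms(5)[of 0] assms(5)[of 1] assms(5)[of 2] e e' unfolding less_3_cases
    by (auto simp: coord_def)
  then show ?thesis using assms(2,3) u unfolding e e' by cases blast+
qed

lemma finite_homs [simp]: "finite V \<Longrightarrow> finite (homs n Q V P)"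
  by (simp add: homs_def finite_PiE)

lemma finite_embs [simp]: "finite V \<Longrightarrow> finite (embs n Q V P)"
  by (simp add: embs_def)

text \<open>Sum the sizes of the fibres: each has at least two elements, except possibly the one
  over \<open>y\<close>, which has at least one if it occurs. In the rooted setting \<open>y\<close>
  is the line of the root.\<close>

lemma card_image_repeated:
  assumes "finite P" and rep: "\<And>x. x \<in> P \<Longrightarrow> f x \<noteq> y \<Longrightarrow> \<exists>x'\<in>P. x' \<noteq> x \<and> f x' = f x"
  shows "2 * card (f ` P - {y}) + card (f ` P \<inter> {y}) \<le> card P"
proof -
  let ?d = "\<lambda>z. card {x \<in> P. f x = z}"
  have fin: "finite {x \<in> P. f x = z}" for z using assms(1) by simp
  have two: "2 \<le> ?d z" if "z \<in> f ` P - {y}" for z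
  proof -
    from that obtain x where x: "x \<in> P" "f x = z" "z \<noteq> y" by blast
    then obtain x' where x': "x' \<in> P" "x' \<noteq> x" "f x' = z" using rep[of x] by blast
    have "card {x, x'} \<le> ?d z" using x x' fin by (intro card_mono) auto
    then show ?thesis using x' by simp
  qed
  have one: "1 \<le> ?d z" if "z \<in> f ` P \<inter> {y}" for z
  proof -
    have "{x \<in> P. f x = z} \<noteq> {}" using that by auto
    then have "card {x \<in> P. f x = z} > 0" using fin by (simp add: card_gt_0_iff)
    then show ?thesis by simp
  qed
  have "card P = (\<Sum>z\<in>f ` P. ?d z)"
    using sum.image_gen[OF assms(1), of "\<lambda>_. 1 :: nat" f] by simp
  also have "\<dots> = (\<Sum>z\<in>f ` P - {y}. ?d z) + (\<Sum>z\<in>f ` P \<inter> {y}. ?d z)"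
    using assms(1) by (subst sum.union_disjoint[symmetric]) (auto intro!: sum.cong)
  also have "\<dots> \<ge> (\<Sum>z\<in>f ` P - {y}. 2) + (\<Sum>z\<in>f ` P \<inter> {y}. 1)"
    using two one by (intro add_mono sum_mono) auto
  finally show ?thesis by (simp add: mult.commute)
qed

lemma sparse_subset: "sparse_entries P \<Longrightarrow> F \<subseteq> P \<Longrightarrow> sparse_entries F"
  unfolding sparse_entries_def by blast

text \<open>Otherwise every line lies on two entries, and counting the three incidences of each
  entry contradicts sparseness.\<close>

lemma sparse_degenerate:
  assumes "sparse_entries P" "finite P" "P \<noteq> {}"
  shows "\<exists>g\<in>P. \<exists>i<3. (i, coord i g) \<notin> lines_of (P - {g})"
proof (rule ccontr)
  assume "\<not> ?thesis"
  then have rep: "\<exists>g'\<in>P. g' \<noteq> g \<and> coord i g' = coord i g" if "g \<in> P" "i < 3" for g i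
    using that unfolding mem_lines_of by force
  have "2 * card (coord i ` P) \<le> card P" if "i < 3" for i
  proof -
    have "2 * card (coord i ` P - {y}) + card (coord i ` P \<inter> {y}) \<le> card P" for y
      using card_image_repeated[OF assms(2), of "coord i" y] rep that by blast
    \<comment> \<open>With \<open>y\<close> outside the image there is no exceptional fibre.\<close>
    moreover obtain y where "y \<notin> coord i ` P" using assms(2) by (meson ex_new_if_finite finite_imageI infinite_UNIV_nat)
    ultimately show ?thesis by (metis Diff_insert0 Diff_empty add_leD1)
  qed
  from this[of 0] this[of 1] this[of 2] have "2 * card (lines_of P) \<le> 3 * card P"
    unfolding card_lines_of[OF assms(2)] by simp
  then show False using assms unfolding sparse_entries_def by force
qed

text \<open>Let \<open>A i\<close> count the lines of type \<open>i\<close> of \<open>F\<close> that are not on \<open>e\<close>, and let \<open>d i\<close> be 1 or 0 according to whether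
  \<open>F\<close> meets the \<open>i\<close>-th line of \<open>e\<close>. If the lemma fails then \<open>2 * A i + d i \<le> card F\<close>. Sparseness of \<open>F\<close> and
  of \<open>insert e F\<close> excludes that the \<open>d i\<close> are all equal and otherwise turns these bounds into
  equalities, which then disagree about the parity of \<open>card F\<close>.\<close>

lemma sparse_degenerate_rooted:
  assumes sp: "sparse_entries (insert e F)" and fin: "finite F" and "F \<noteq> {}" "e \<notin> F"
  shows "\<exists>g\<in>F. \<exists>i<3. (i, coord i g) \<notin> lines_of (insert e (F - {g}))"
proof (rule ccontr)
  assume "\<not> ?thesis"
  then have rep: "\<exists>g'\<in>F. g' \<noteq> g \<and> coord i g' = coord i g" if "g \<in> F" "i < 3" "coord i g \<noteq> coord i e" for g i
    using that unfolding mem_lines_of by force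
  define A where "A i = card (coord i ` F - {coord i e})" for i
  define d where "d i = card (coord i ` F \<inter> {coord i e})" for i
  have 1: "2 * A i + d i \<le> card F" if "i < 3" for i
    unfolding A_def d_def by (rule card_image_repeated[OF fin]) (use rep that in blast)
  have 2: "d i \<le> 1" for i
    unfolding d_def by (metis card.empty card_insert_le_m1 card_mono finite.emptyI finite_insert inf_le2 is_singletonI is_singleton_altdef)
  have 3: "card (coord i ` F) = A i + d i" for i
    unfolding A_def d_def using fin
    by (subst card_Un_disjoint[symmetric]) (auto intro!: arg_cong[of _ _ card])
  have 4: "card (coord i ` insert e F) = A i + 1" for i
  proof -
    have "coord i ` insert e F = insert (coord i e) (coord i ` F - {coord i e})" by auto
    then show ?thesis
      unfolding A_def by (simp only:) (subst card_insert_disjoint, use fin in auto)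
  qed
  have 5: "3 * card F < 2 * card (lines_of F)"
    using sp \<open>F \<noteq> {}\<close> unfolding sparse_entries_def by blast
  have 6: "3 * card (insert e F) < 2 * card (lines_of (insert e F))"
    using sp unfolding sparse_entries_def by blast
  have 7: "3 * card F < 2 * (A 0 + d 0 + (A 1 + d 1) + (A 2 + d 2))"
    using 5 unfolding card_lines_of[OF fin] 3 .
  have 8: "3 * (card F + 1) < 2 * (A 0 + 1 + (A 1 + 1) + (A 2 + 1))"
    using 6 fin \<open>e \<notin> F\<close> unfolding card_lines_of[OF finite.insertI[OF fin]] 4 by simp
  have "2 * A 0 + d 0 \<le> card F" "2 * A 1 + d 1 \<le> card F" "2 * A 2 + d 2 \<le> card F" using 1 by auto
  moreover have "d 0 = 0 \<or> d 0 = 1" "d 1 = 0 \<or> d 1 = 1" "d 2 = 0 \<or> d 2 = 1" using 2[of 0] 2[of 1] 2[of 2] by auto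
  ultimately show False using 7 8 by presburger
qed

text \<open>The entries of \<open>P\<close> can be removed one at a time such that each has at that moment a line outside
  \<open>V\<^sub>0\<close> that lies on no other entry.\<close>

definition degenerate :: "(nat \<times> nat) set \<Rightarrow> entry set \<Rightarrow> bool" where
  "degenerate V\<^sub>0 P \<longleftrightarrow> (\<forall>F\<subseteq>P. F \<noteq> {} \<longrightarrow> (\<exists>g\<in>F. \<exists>i<3. (i, coord i g) \<notin> V\<^sub>0 \<union> lines_of (F - {g})))"

text \<open>Peel off an entry that has a line of its own outside the root. In a partial Latin square
  the image of that line is forced by the images of the other two, so restricting a map to the
  remaining lines loses nothing. Every entry thus uses up one free line. The first claim guarantees
  that the subtraction in the exponent is not truncated.\<close>

lemma card_homs_rooted_le:
  assumes "finite P" "finite V" "lines_of P \<subseteq> V" "V\<^sub>0 \<subseteq> V" "degenerate V\<^sub>0 P" "partial_latin_square n Q"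
  shows "card V\<^sub>0 + card P \<le> card V"
    "card {\<phi> \<in> homs n Q V P. \<forall>l\<in>V\<^sub>0. \<phi> l = \<psi> l} \<le> n ^ (card V - (card V\<^sub>0 + card P))"
proof -
  have "card V\<^sub>0 + card P \<le> card V \<and>
    card {\<phi> \<in> homs n Q V P. \<forall>l\<in>V\<^sub>0. \<phi> l = \<psi> l} \<le> n ^ (card V - (card V\<^sub>0 + card P))"
    using assms
  proof (induction "card P" arbitrary: P V)
    case 0
    then have P: "P = {}" by simp
    have fin0: "finite V\<^sub>0" using 0 finite_subset by blast
    have "inj_on (\<lambda>\<phi>. restrict \<phi> (V - V\<^sub>0)) {\<phi> \<in> homs n Q V P. \<forall>l\<in>V\<^sub>0. \<phi> l = \<psi> l}"
    proof (rule inj_onI, clarify)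
      fix \<phi> \<phi>' assume h: "\<phi> \<in> homs n Q V P" "\<phi>' \<in> homs n Q V P" "\<forall>l\<in>V\<^sub>0. \<phi> l = \<psi> l" "\<forall>l\<in>V\<^sub>0. \<phi>' l = \<psi> l"
        "restrict \<phi> (V - V\<^sub>0) = restrict \<phi>' (V - V\<^sub>0)"
      show "\<phi> = \<phi>'"
      proof (rule extensionalityI)
        show "\<phi> \<in> extensional V" "\<phi>' \<in> extensional V" using h by (auto simp: homs_def PiE_def)
        show "\<phi> l = \<phi>' l" if "l \<in> V" for l
          using that h(3,4) fun_cong[OF h(5), of l] by (cases "l \<in> V\<^sub>0") auto
      qed
    qed
    then have "card {\<phi> \<in> homs n Q V P. \<forall>l\<in>V\<^sub>0. \<phi> l = \<psi> l} \<le> card ((V - V\<^sub>0) \<rightarrow>\<^sub>E {1..n})"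
      by (rule card_inj_on_le) (use 0 in \<open>auto simp: homs_def intro!: finite_PiE\<close>)
    also have "\<dots> = n ^ (card V - card V\<^sub>0)"
      using 0 fin0 by (simp add: card_PiE card_Diff_subset)
    finally show ?case using P 0 card_mono[of V V\<^sub>0] by simp
  next
    case (Suc m)
    have "P \<noteq> {}" using Suc by auto
    then obtain g i where g: "g \<in> P" "i < 3" and new: "(i, coord i g) \<notin> V\<^sub>0 \<union> lines_of (P - {g})"
      using Suc.prems(5) unfolding degenerate_def by blast
    let ?l = "(i, coord i g)"
    define V' where "V' = V - {?l}"
    define P' where "P' = P - {g}"
    have lV: "?l \<in> V" using Suc.prems(3) g lines_ofI by blast
    have cP: "card P' = m" using Suc g by (simp add: P'_def)
    have cV: "card V = Suc (card V')" using lV Suc.prems(2) by (metis V'_def card_Suc_Diff1)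
    have deg: "degenerate V\<^sub>0 P'" using Suc.prems(5) unfolding degenerate_def P'_def by blast
    have sub: "lines_of P' \<subseteq> V'"
      using lines_of_mono[of P' P] Suc.prems(3) new by (auto simp: V'_def P'_def)
    have sub0: "V\<^sub>0 \<subseteq> V'" using Suc.prems(4) new by (auto simp: V'_def)
    have IH: "card V\<^sub>0 + card P' \<le> card V' \<and>
      card {\<phi> \<in> homs n Q V' P'. \<forall>l\<in>V\<^sub>0. \<phi> l = \<psi> l} \<le> n ^ (card V' - (card V\<^sub>0 + card P'))"
      using Suc.prems cP deg sub sub0 by (intro Suc.hyps(1)) (auto simp: P'_def V'_def)
    have "inj_on (\<lambda>\<phi>. restrict \<phi> V') {\<phi> \<in> homs n Q V P. \<forall>l\<in>V\<^sub>0. \<phi> l = \<psi> l}"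
    proof (rule inj_onI, clarify)
      fix \<phi> \<phi>' assume h: "\<phi> \<in> homs n Q V P" "\<phi>' \<in> homs n Q V P" "restrict \<phi> V' = restrict \<phi>' V'"
      have eq: "\<phi> l = \<phi>' l" if "l \<in> V'" for l using fun_cong[OF h(3), of l] that by simp
      have m: "map_entry \<phi> g = map_entry \<phi>' g"
      proof (rule partial_latin_square_unique[OF Suc.prems(6) _ _ g(2)])
        show "map_entry \<phi> g \<in> Q" "map_entry \<phi>' g \<in> Q" using h g by (auto simp: homs_def)
        show "coord j (map_entry \<phi> g) = coord j (map_entry \<phi>' g)" if "j < 3" "j \<noteq> i" for j
        proof -
          have "(j, coord j g) \<in> V'" using lines_ofI[OF g(1) that(1)] Suc.prems(3) that by (auto simp: V'_def)
          then show ?thesis using eq that by (simp add: coord_map_entry)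
        qed
      qed
      have "\<phi> ?l = \<phi>' ?l" using arg_cong[OF m, of "coord i"] g by (simp add: coord_map_entry)
      show "\<phi> = \<phi>'"
      proof (rule extensionalityI)
        show "\<phi> \<in> extensional V" "\<phi>' \<in> extensional V" using h by (auto simp: homs_def PiE_def)
        show "\<phi> l = \<phi>' l" if "l \<in> V" for l
          using eq[of l] \<open>\<phi> ?l = \<phi>' ?l\<close> that unfolding V'_def by (cases "l = ?l") auto
      qed
    qed
    then have "card {\<phi> \<in> homs n Q V P. \<forall>l\<in>V\<^sub>0. \<phi> l = \<psi> l} \<le> card {\<phi> \<in> homs n Q V' P'. \<forall>l\<in>V\<^sub>0. \<phi> l = \<psi> l}"
    proof (rule card_inj_on_le)
      show "finite {\<phi> \<in> homs n Q V' P'. \<forall>l\<in>V\<^sub>0. \<phi> l = \<psi> l}" using Suc.prems by (simp add: V'_def)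
      show "(\<lambda>\<phi>. restrict \<phi> V') ` {\<phi> \<in> homs n Q V P. \<forall>l\<in>V\<^sub>0. \<phi> l = \<psi> l} \<subseteq> {\<phi> \<in> homs n Q V' P'. \<forall>l\<in>V\<^sub>0. \<phi> l = \<psi> l}"
      proof clarify
        fix \<phi> assume h: "\<phi> \<in> homs n Q V P" "\<forall>l\<in>V\<^sub>0. \<phi> l = \<psi> l"
        have "map_entry (restrict \<phi> V') e = map_entry \<phi> e" if "e \<in> P'" for e
          by (rule entry_eqI) (use that sub lines_ofI[OF that] in \<open>auto simp: coord_map_entry\<close>)
        then show "restrict \<phi> V' \<in> homs n Q V' P' \<and> (\<forall>l\<in>V\<^sub>0. restrict \<phi> V' l = \<psi> l)"
          using h sub0 by (auto simp: homs_def P'_def V'_def PiE_iff)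
      qed
    qed
    also have "\<dots> \<le> n ^ (card V' - (card V\<^sub>0 + card P'))" using IH by simp
    finally show ?case using IH cP cV Suc.hyps(2)[symmetric] by simp
  qed
  then show "card V\<^sub>0 + card P \<le> card V"
    "card {\<phi> \<in> homs n Q V P. \<forall>l\<in>V\<^sub>0. \<phi> l = \<psi> l} \<le> n ^ (card V - (card V\<^sub>0 + card P))" by auto
qed

section \<open>Encoding Latin squares with many closed embeddings\<close>

text \<open>\<open>f\<close> is encoded by \<open>T\<close>, \<open>X\<close>, its values outside \<open>X\<close>, and the positions of its values on \<open>X\<close> in the
  candidate sets.\<close>

lemma card_predictable_functions_le:
  fixes cand :: "'x set \<Rightarrow> ('x \<Rightarrow> 'y) \<Rightarrow> 'x \<Rightarrow> 'y set" and \<delta> :: real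
  assumes fin: "finite U" "finite A" and n: "card A = n" and K: "1 \<le> K" "K \<le> n"
    and cand: "\<And>T h x. finite (cand T h x)" "\<And>T h x. card (cand T h x) \<le> K"
    and F: "\<And>f. f \<in> F \<Longrightarrow> f \<in> U \<rightarrow>\<^sub>E A"
      "\<And>f. f \<in> F \<Longrightarrow> \<exists>T X. X \<subseteq> U \<and> T \<subseteq> U - X \<and> \<delta> * card U \<le> card X \<and> (\<forall>x\<in>X. f x \<in> cand T (restrict f T) x)"
  shows "real (card F) \<le> 4 ^ card U * (real n ^ card U * (real K / n) powr (\<delta> * card U))"
proof -
  define I where "I = {(T, X). X \<subseteq> U \<and> T \<subseteq> U - X \<and> \<delta> * card U \<le> card X}"
  define G where "G = (\<lambda>(T, X). {f \<in> U \<rightarrow>\<^sub>E A. \<forall>x\<in>X. f x \<in> cand T (restrict f T) x})"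
  have I: "I \<subseteq> Pow U \<times> Pow U" by (auto simp: I_def)
  then have finI: "finite I" using fin finite_subset by fastforce
  have "card I \<le> card (Pow U \<times> Pow U)" using I fin by (intro card_mono) auto
  then have cI: "real (card I) \<le> 4 ^ card U"
    using fin by (simp add: card_cartesian_product card_Pow power_mult_distrib[symmetric])
  have G: "real (card (G p)) \<le> real n ^ card U * (real K / n) powr (\<delta> * card U)" if "p \<in> I" for p
  proof -
    obtain T X where p: "p = (T, X)" by fastforce
    have X: "X \<subseteq> U" "T \<subseteq> U - X" "\<delta> * card U \<le> card X" using that by (auto simp: I_def p)
    have finX: "finite X" using X fin finite_subset by blast
    let ?S = "SIGMA h:(U - X) \<rightarrow>\<^sub>E A. PiE X (cand T (restrict h T))"
    have finS: "finite ?S" using fin finX cand by (intro finite_SigmaI finite_PiE) auto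
    \<comment> \<open>\<open>T\<close> is disjoint from \<open>X\<close>, so the values outside
      \<open>X\<close> already determine the candidate sets.\<close>
    have iT: "(U - X) \<inter> T = T" using X by auto
    have "inj_on (\<lambda>f. (restrict f (U - X), restrict f X)) (G p)"
    proof (rule inj_onI)
      fix f g assume h: "f \<in> G p" "g \<in> G p" "(restrict f (U - X), restrict f X) = (restrict g (U - X), restrict g X)"
      show "f = g"
      proof (rule extensionalityI)
        show "f \<in> extensional U" "g \<in> extensional U" using h by (auto simp: G_def p PiE_def)
        show "f x = g x" if "x \<in> U" for x
          using h(3) that by (cases "x \<in> X") (auto dest: fun_cong[of _ _ x])
      qed
    qed
    moreover have "(\<lambda>f. (restrict f (U - X), restrict f X)) ` G p \<subseteq> ?S"
      using X(1) by (auto simp: G_def p iT)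
    ultimately have "card (G p) \<le> card ?S" using finS by (rule card_inj_on_le)
    also have "\<dots> = (\<Sum>h\<in>(U - X) \<rightarrow>\<^sub>E A. \<Prod>x\<in>X. card (cand T (restrict h T) x))"
      using fin finX cand by (simp add: finite_PiE card_PiE)
    also have "\<dots> \<le> (\<Sum>h\<in>(U - X) \<rightarrow>\<^sub>E A. K ^ card X)"
      using cand by (intro sum_mono) (auto intro!: prod_le_power K)
    also have "\<dots> = n ^ (card U - card X) * K ^ card X"
      using fin X(1) finX n by (simp add: card_PiE card_Diff_subset)
    finally have "real (card (G p)) \<le> real (n ^ (card U - card X) * K ^ card X)"
      by (simp only: of_nat_le_iff)
    also have "\<dots> = real n ^ card U * (real K / n) ^ card X"
    proof -
      have "real n ^ card U = real n ^ (card U - card X) * real n ^ card X"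
        using card_mono[OF fin(1) X(1)] by (simp add: power_add[symmetric])
      then show ?thesis using K by (simp add: power_divide)
    qed
    also have "\<dots> \<le> real n ^ card U * (real K / n) powr (\<delta> * card U)"
    proof (rule mult_left_mono)
      have "(real K / n) ^ card X = (real K / n) powr card X"
        using K by (simp add: powr_realpow)
      also have "\<dots> \<le> (real K / n) powr (\<delta> * card U)"
        using K X(3) by (intro powr_mono') auto
      finally show "(real K / n) ^ card X \<le> (real K / n) powr (\<delta> * card U)" .
    qed simp
    finally show ?thesis .
  qed
  have "F \<subseteq> (\<Union>p\<in>I. G p)"
  proof
    fix f assume f: "f \<in> F"
    then obtain T X where "X \<subseteq> U \<and> T \<subseteq> U - X \<and> \<delta> * card U \<le> card X \<and> (\<forall>x\<in>X. f x \<in> cand T (restrict f T) x)"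
      using F(2)[OF f] by (elim exE)
    then have "(T, X) \<in> I" "f \<in> G (T, X)" using F(1)[OF f] by (auto simp: I_def G_def)
    then show "f \<in> (\<Union>p\<in>I. G p)" by blast
  qed
  moreover have "finite (G p)" for p
    by (rule finite_subset[of _ "U \<rightarrow>\<^sub>E A"]) (auto simp: G_def fin finite_PiE split: prod.splits)
  ultimately have "card F \<le> card (\<Union>p\<in>I. G p)"
    using finI by (intro card_mono) auto
  also have "\<dots> \<le> (\<Sum>p\<in>I. card (G p))" by (rule card_UN_le[OF finI])
  finally have "real (card F) \<le> (\<Sum>p\<in>I. real (card (G p)))" unfolding of_nat_sum[symmetric] of_nat_le_iff .
  also have "\<dots> \<le> (\<Sum>p\<in>I. real n ^ card U * (real K / n) powr (\<delta> * card U))"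
    using G by (intro sum_mono) auto
  also have "\<dots> = card I * (real n ^ card U * (real K / n) powr (\<delta> * card U))" by simp
  also have "\<dots> \<le> 4 ^ card U * (real n ^ card U * (real K / n) powr (\<delta> * card U))"
    using cI by (intro mult_right_mono) auto
  finally show ?thesis .
qed

section \<open>Random sets of revealed cells\<close>

lemma card_supersets_avoiding:
  assumes "finite U" "B \<subseteq> U" "x \<in> U" "x \<notin> B" "card B \<le> m"
  shows "2 ^ card U \<le> 2 ^ (m + 1) * card {T \<in> Pow U. B \<subseteq> T \<and> x \<notin> T}"
proof -
  have fB: "finite B" using assms finite_subset by blast
  have bij: "bij_betw (\<lambda>S. S \<union> B) (Pow (U - B - {x})) {T \<in> Pow U. B \<subseteq> T \<and> x \<notin> T}"
    by (rule bij_betw_byWitness[where f' = "\<lambda>T. T - B"]) (use assms in auto)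
  have "card {T \<in> Pow U. B \<subseteq> T \<and> x \<notin> T} = 2 ^ card (U - B - {x})"
    using bij_betw_same_card[OF bij] assms(1) by (simp add: card_Pow)
  moreover have "card (U - B - {x}) + card B + 1 = card U"
  proof -
    have "card (U - insert x B) = card U - card (insert x B)" using assms fB by (intro card_Diff_subset) auto
    moreover have "card (insert x B) \<le> card U" using assms by (intro card_mono) auto
    moreover have "U - insert x B = U - B - {x}" by auto
    ultimately show ?thesis using assms fB by simp
  qed
  then have "(2::nat) ^ card U \<le> 2 ^ (m + 1 + card (U - B - {x}))"
    using assms(5) by (intro power_increasing) auto
  ultimately show ?thesis by (simp add: power_add)
qed

text \<open>A uniformly random \<open>T\<close> contains \<open>B \<psi>\<close> and misses
  \<open>x \<psi>\<close> with probability at least 2 ^ -(m + 1), and some \<open>T\<close> does as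
  well as the average. In the application \<open>T\<close> is the revealed set,
  \<open>B \<psi>\<close> the cells that a prediction reads and \<open>x \<psi>\<close> the cell
  that it predicts.\<close>

lemma exists_splitting_subset:
  assumes fin: "finite U" "finite \<Psi>"
    and B: "\<And>\<psi>. \<psi> \<in> \<Psi> \<Longrightarrow> B \<psi> \<subseteq> U" "\<And>\<psi>. \<psi> \<in> \<Psi> \<Longrightarrow> card (B \<psi>) \<le> m"
    and x: "\<And>\<psi>. \<psi> \<in> \<Psi> \<Longrightarrow> x \<psi> \<in> U" "\<And>\<psi>. \<psi> \<in> \<Psi> \<Longrightarrow> x \<psi> \<notin> B \<psi>"
  shows "\<exists>T\<subseteq>U. card \<Psi> \<le> 2 ^ (m + 1) * card {\<psi> \<in> \<Psi>. B \<psi> \<subseteq> T \<and> x \<psi> \<notin> T}"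
proof (rule ccontr)
  assume "\<not> ?thesis"
  then have c: "2 ^ (m + 1) * card {\<psi> \<in> \<Psi>. B \<psi> \<subseteq> T \<and> x \<psi> \<notin> T} < card \<Psi>" if "T \<in> Pow U" for T
    using that by (auto simp: not_le)
  have "card \<Psi> * 2 ^ card U = (\<Sum>\<psi>\<in>\<Psi>. 2 ^ card U)" by simp
  also have "\<dots> \<le> (\<Sum>\<psi>\<in>\<Psi>. 2 ^ (m + 1) * card {T \<in> Pow U. B \<psi> \<subseteq> T \<and> x \<psi> \<notin> T})"
    using fin B x by (intro sum_mono card_supersets_avoiding) auto
  also have "\<dots> = 2 ^ (m + 1) * (\<Sum>\<psi>\<in>\<Psi>. \<Sum>T | T \<in> Pow U \<and> B \<psi> \<subseteq> T \<and> x \<psi> \<notin> T. 1)"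
    by (simp add: sum_distrib_left)
  also have "(\<Sum>\<psi>\<in>\<Psi>. \<Sum>T | T \<in> Pow U \<and> B \<psi> \<subseteq> T \<and> x \<psi> \<notin> T. 1)
      = (\<Sum>T\<in>Pow U. \<Sum>\<psi> | \<psi> \<in> \<Psi> \<and> B \<psi> \<subseteq> T \<and> x \<psi> \<notin> T. (1::nat))"
    by (rule sum.swap_restrict) (use fin in auto)
  also have "2 ^ (m + 1) * \<dots> = (\<Sum>T\<in>Pow U. 2 ^ (m + 1) * card {\<psi> \<in> \<Psi>. B \<psi> \<subseteq> T \<and> x \<psi> \<notin> T})"
    by (simp add: sum_distrib_left)
  also have "\<dots> < (\<Sum>T\<in>Pow U. card \<Psi>)"
    using c fin by (intro sum_strict_mono) auto
  also have "\<dots> = card \<Psi> * 2 ^ card U" using fin by (simp add: card_Pow)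
  finally show False by simp
qed

text \<open>Restricted to the cells so that it belongs to the extensional function space in which
  \<open>card_predictable_functions_le\<close> counts.\<close>

definition symbol_at :: "nat \<Rightarrow> entry set \<Rightarrow> nat \<times> nat \<Rightarrow> nat" where
  "symbol_at n L = (\<lambda>x\<in>{1..n} \<times> {1..n}. SOME s. (fst x, snd x, s) \<in> L)"

lemma symbol_at:
  assumes "latin_square n L"
  shows "(a, b, s) \<in> L \<longleftrightarrow> a \<in> {1..n} \<and> b \<in> {1..n} \<and> s = symbol_at n L (a, b)"
proof -
  have L: "partial_latin_square n L" "\<forall>r\<in>{1..n}. \<forall>c\<in>{1..n}. \<exists>s. (r, c, s) \<in> L"
    using assms by (simp_all add: latin_square_def)
  have "(a, b, symbol_at n L (a, b)) \<in> L" if "a \<in> {1..n}" "b \<in> {1..n}"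
    using someI_ex[OF L(2)[rule_format, OF that]] that by (simp add: symbol_at_def)
  then show ?thesis using partial_latin_squareD(1,2)[OF L(1), of a b] by blast
qed

lemma inj_on_symbol_at: "inj_on (symbol_at n) {L. latin_square n L}"
proof (rule inj_onI, clarify)
  fix L L' assume h: "latin_square n L" "latin_square n L'" "symbol_at n L = symbol_at n L'"
  have "x \<in> L \<longleftrightarrow> x \<in> L'" for x
    by (cases x) (simp only: symbol_at[OF h(1)] symbol_at[OF h(2)] h(3))
  then show "L = L'" by blast
qed

text \<open>The embeddings that cannot be extended by an entry in the cell of \<open>e\<close> with a new symbol, because the symbol of
  that cell is already the image of the symbol of \<open>e\<close>.\<close>

definition closed_embs :: "nat \<Rightarrow> entry set \<Rightarrow> (nat \<times> nat) set \<Rightarrow> entry set \<Rightarrow> entry \<Rightarrow> (nat \<times> nat \<Rightarrow> nat) set" where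
  "closed_embs n L V P e = {\<phi> \<in> embs n L V P. map_entry \<phi> e \<in> L}"

lemma partial_latin_square_subset: "partial_latin_square n Q \<Longrightarrow> Q' \<subseteq> Q \<Longrightarrow> partial_latin_square n Q'"
  unfolding partial_latin_square_def by (meson subset_iff subset_trans)

text \<open>Choose revealed cells \<open>T\<close> that suit a fixed proportion of the closed
  embeddings. Each of these predicts, from the entries in \<open>T\<close> alone, the true symbol of
  a cell outside \<open>T\<close>. No cell receives more than n ^ k of them, so their number forces
  at least \<epsilon> n ^ 2 cells to receive \<epsilon> n ^ k or more.\<close>

lemma closed_embs_predict:
  fixes \<epsilon> :: real
  assumes fin: "finite V" "finite P" and V: "lines_of P \<subseteq> V" "(0, r) \<in> V" "(1, c) \<in> V" "(2, s) \<in> V"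
    and cell: "\<And>t. (r, c, t) \<notin> P" and deg: "degenerate {(0, r), (1, c)} P"
    and k: "card V = k + 2 + card P" and \<epsilon>: "\<epsilon> > 0" and n: "n > 0"
    and L: "latin_square n L" and many: "2 ^ (card P + 2) * \<epsilon> * real n ^ (k + 2) \<le> card (closed_embs n L V P (r, c, s))"
  shows "\<exists>T X. X \<subseteq> {1..n} \<times> {1..n} \<and> T \<subseteq> {1..n} \<times> {1..n} - X \<and> \<epsilon> * card ({1..n} \<times> {1..n}) \<le> card X \<and>
    (\<forall>x\<in>X. \<epsilon> * real n ^ k \<le> card {\<phi> \<in> homs n {e \<in> L. (fst e, fst (snd e)) \<in> T} V P.
      \<phi> (0, r) = fst x \<and> \<phi> (1, c) = snd x \<and> \<phi> (2, s) = symbol_at n L x})"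
proof -
  let ?U = "{1..n} \<times> {1..n}"
  define \<Psi> where "\<Psi> = closed_embs n L V P (r, c, s)"
  define B where "B \<psi> = (\<lambda>e. (\<psi> (0, fst e), \<psi> (1, fst (snd e)))) ` P" for \<psi> :: "nat \<times> nat \<Rightarrow> nat"
  define x where "x \<psi> = (\<psi> (0, r), \<psi> (1, c))" for \<psi> :: "nat \<times> nat \<Rightarrow> nat"
  have Lp: "partial_latin_square n L" using L by (simp add: latin_square_def)
  have fin\<Psi>: "finite \<Psi>" using fin by (simp add: \<Psi>_def closed_embs_def)
  have mem: "(0, fst e) \<in> V" "(1, fst (snd e)) \<in> V" if "e \<in> P" for e
    using lines_ofI[OF that, of 0] lines_ofI[OF that, of 1] V(1) by (auto simp: coord_def split: prod.splits)
  have \<psi>V: "\<psi> l \<in> {1..n}" if "\<psi> \<in> \<Psi>" "l \<in> V" for \<psi> l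
    using that unfolding \<Psi>_def closed_embs_def embs_def homs_def by blast
  have \<psi>inj: "l = l'" if "\<psi> \<in> \<Psi>" "l \<in> V" "l' \<in> V" "fst l = fst l'" "\<psi> l = \<psi> l'" for \<psi> l l'
    using that unfolding \<Psi>_def closed_embs_def embs_def by blast
  have x: "x \<psi> \<in> ?U" "x \<psi> \<notin> B \<psi>" if \<psi>: "\<psi> \<in> \<Psi>" for \<psi>
  proof -
    show "x \<psi> \<in> ?U" using \<psi>V[OF \<psi>] V by (auto simp: x_def)
    \<comment> \<open>Injectivity on rows and on columns is used here: a prediction that read its
      own cell would come from an entry of \<open>P\<close> in the cell
      \<open>(r, c)\<close>.\<close>
    show "x \<psi> \<notin> B \<psi>"
    proof
      assume "x \<psi> \<in> B \<psi>"
      then obtain e where e: "e \<in> P" "\<psi> (0, r) = \<psi> (0, fst e)" "\<psi> (1, c) = \<psi> (1, fst (snd e))"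
        by (auto simp: x_def B_def)
      then have "r = fst e" "c = fst (snd e)"
        using \<psi>inj[OF \<psi> V(2) mem(1)[OF e(1)]] \<psi>inj[OF \<psi> V(3) mem(2)[OF e(1)]] by auto
      then have "(r, c, snd (snd e)) \<in> P" using e(1) by simp
      then show False using cell by blast
    qed
  qed
  have BU: "B \<psi> \<subseteq> ?U" if "\<psi> \<in> \<Psi>" for \<psi>
    unfolding B_def using \<psi>V[OF that] mem by blast
  have Bc: "card (B \<psi>) \<le> card P" for \<psi> unfolding B_def by (rule card_image_le[OF fin(2)])
  have finU: "finite ?U" by simp
  obtain T where T: "T \<subseteq> ?U" "card \<Psi> \<le> 2 ^ (card P + 1) * card {\<psi> \<in> \<Psi>. B \<psi> \<subseteq> T \<and> x \<psi> \<notin> T}"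
    using exists_splitting_subset[OF finU fin\<Psi>, of B "card P" x] BU Bc x by blast
  define \<Psi>' where "\<Psi>' = {\<psi> \<in> \<Psi>. B \<psi> \<subseteq> T \<and> x \<psi> \<notin> T}"
  define Q where "Q = {e \<in> L. (fst e, fst (snd e)) \<in> T}"
  have Q: "partial_latin_square n Q" by (rule partial_latin_square_subset[OF Lp]) (auto simp: Q_def)
  \<comment> \<open>How often the revealed part \<open>Q\<close> predicts the true symbol of the
    cell \<open>y\<close>; rooting at the row and the column of \<open>y\<close> bounds this by n ^
    k.\<close>
  define W where "W y = {\<phi> \<in> homs n Q V P. \<phi> (0, r) = fst y \<and> \<phi> (1, c) = snd y \<and> \<phi> (2, s) = symbol_at n L y}" for y
  have W: "card (W y) \<le> n ^ k" for y
  proof -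
    define \<theta> :: "nat \<times> nat \<Rightarrow> nat" where "\<theta> l = (if l = (0, r) then fst y else snd y)" for l
    have "card (W y) \<le> card {\<phi> \<in> homs n Q V P. \<forall>l\<in>{(0, r), (1, c)}. \<phi> l = \<theta> l}"
      using fin by (intro card_mono) (auto simp: W_def \<theta>_def)
    also have "\<dots> \<le> n ^ (card V - (card {(0::nat, r), (1, c)} + card P))"
      using V by (intro card_homs_rooted_le(2) fin deg Q) auto
    also have "\<dots> = n ^ k" using k by simp
    finally show ?thesis .
  qed
  have sub: "{\<psi> \<in> \<Psi>'. x \<psi> = y} \<subseteq> W y" for y
  proof
    fix \<psi> assume "\<psi> \<in> {\<psi> \<in> \<Psi>'. x \<psi> = y}"
    then have \<psi>: "\<psi> \<in> \<Psi>" "B \<psi> \<subseteq> T" "y = (\<psi> (0, r), \<psi> (1, c))" by (auto simp: \<Psi>'_def x_def)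
    have "map_entry \<psi> (r, c, s) \<in> L" using \<psi>(1) by (simp add: \<Psi>_def closed_embs_def)
    then have "\<psi> (2, s) = symbol_at n L y" unfolding \<psi>(3) by (simp add: map_entry_def symbol_at[OF L])
    moreover have "\<psi> \<in> homs n L V P" using \<psi>(1) by (simp add: \<Psi>_def closed_embs_def embs_def)
    then have "\<psi> \<in> homs n Q V P"
      using \<psi>(2) by (fastforce simp: homs_def Q_def B_def map_entry_def)
    ultimately show "\<psi> \<in> W y" using \<psi>(3) by (simp add: W_def)
  qed
  define X where "X = {y \<in> ?U - T. \<epsilon> * real n ^ k \<le> card (W y)}"
  have finW: "finite (W y)" for y using fin by (simp add: W_def)
  \<comment> \<open>The splitting consumes card P + 1 of the card P + 2 factors 2. The last one
    leaves room for the light cells: they account for at most \<epsilon> n ^ (k + 2), so the heavy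
    ones account for at least that.\<close>
  have "2 ^ (card P + 1) * (2 * \<epsilon> * real n ^ (k + 2)) \<le> real (card \<Psi>)"
    using many by (simp add: \<Psi>_def mult_ac)
  also have "\<dots> \<le> 2 ^ (card P + 1) * real (card \<Psi>')"
  proof -
    have "real (card \<Psi>) \<le> real (2 ^ (card P + 1) * card \<Psi>')"
      using T(2) unfolding \<Psi>'_def of_nat_le_iff .
    then show ?thesis by simp
  qed
  finally have "2 * \<epsilon> * real n ^ (k + 2) \<le> real (card \<Psi>')" by simp
  also have "real (card \<Psi>') = (\<Sum>y\<in>?U - T. real (card {\<psi> \<in> \<Psi>'. x \<psi> = y}))"
  proof -
    have "x ` \<Psi>' \<subseteq> ?U - T" using x(1) unfolding \<Psi>'_def by blast
    then have "card \<Psi>' = (\<Sum>y\<in>?U - T. card {\<psi> \<in> \<Psi>'. x \<psi> = y})"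
      using sum.group[of \<Psi>' "?U - T" x "\<lambda>_. 1 :: nat"] fin\<Psi> by (simp add: \<Psi>'_def)
    then show ?thesis by simp
  qed
  also have "\<dots> \<le> (\<Sum>y\<in>?U - T. (if y \<in> X then real n ^ k else 0) + \<epsilon> * real n ^ k)"
  proof (rule sum_mono)
    fix y assume y: "y \<in> ?U - T"
    have "card {\<psi> \<in> \<Psi>'. x \<psi> = y} \<le> card (W y)" by (intro card_mono sub finW)
    then have c: "real (card {\<psi> \<in> \<Psi>'. x \<psi> = y}) \<le> real (card (W y))" by simp
    have m: "real (card (W y)) \<le> real n ^ k" using W[of y] unfolding of_nat_power[symmetric] of_nat_le_iff .
    have p: "0 \<le> \<epsilon> * real n ^ k" using \<epsilon> by simp
    show "real (card {\<psi> \<in> \<Psi>'. x \<psi> = y}) \<le> (if y \<in> X then real n ^ k else 0) + \<epsilon> * real n ^ k"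
    proof (cases "y \<in> X")
      case True
      then show ?thesis unfolding if_P[OF True] using c m p by linarith
    next
      case False
      then have "real (card (W y)) \<le> \<epsilon> * real n ^ k" using y by (simp add: X_def)
      then show ?thesis unfolding if_not_P[OF False] using c by linarith
    qed
  qed
  also have "\<dots> = card X * real n ^ k + card (?U - T) * (\<epsilon> * real n ^ k)"
  proof -
    have "(?U - T) \<inter> X = X" by (auto simp: X_def)
    then have "(\<Sum>y\<in>?U - T. if y \<in> X then real n ^ k else 0) = card X * real n ^ k"
      using sum.inter_restrict[of "?U - T" "\<lambda>_. real n ^ k" X] finU by simp
    then show ?thesis by (simp add: sum.distrib)
  qed
  also have "\<dots> \<le> card X * real n ^ k + (real n)\<^sup>2 * (\<epsilon> * real n ^ k)"
  proof -
    have "card (?U - T) \<le> card ?U" by (intro card_mono) auto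
    then have "real (card (?U - T)) \<le> real (n * n)" unfolding of_nat_le_iff by simp
    then have "real (card (?U - T)) \<le> (real n)\<^sup>2" by (simp add: power2_eq_square)
    then show ?thesis using \<epsilon> by (intro add_left_mono mult_right_mono) auto
  qed
  finally have "2 * (\<epsilon> * (real n)\<^sup>2) * real n ^ k \<le> (card X + \<epsilon> * (real n)\<^sup>2) * real n ^ k"
    by (simp add: power_add power2_eq_square algebra_simps)
  then have "2 * (\<epsilon> * (real n)\<^sup>2) \<le> card X + \<epsilon> * (real n)\<^sup>2" using n by (simp add: mult_le_cancel_right)
  then have "\<epsilon> * card ?U \<le> card X" by (simp add: power2_eq_square)
  moreover have "X \<subseteq> ?U" "T \<subseteq> ?U - X" using T by (auto simp: X_def)
  moreover have "\<forall>y\<in>X. \<epsilon> * real n ^ k \<le> card (W y)" by (auto simp: X_def)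
  ultimately show ?thesis unfolding W_def Q_def by blast
qed

text \<open>The predictions for one cell, over all symbols together, number at most n ^ k; hence at
  most 1 / \<epsilon> symbols can have \<epsilon> n ^ k of them.\<close>

lemma card_heavy_values_le:
  fixes \<epsilon> :: real
  assumes fin: "finite V" "finite P" and V: "lines_of P \<subseteq> V" "(0, r) \<in> V" "(1, c) \<in> V"
    and deg: "degenerate {(0, r), (1, c)} P" and k: "card V = k + 2 + card P" and "\<epsilon> > 0" and n: "n > 0"
    and Q: "partial_latin_square n Q"
  shows "\<epsilon> * card {\<sigma> \<in> {1..n}. \<epsilon> * real n ^ k \<le>
    card {\<phi> \<in> homs n Q V P. \<phi> (0, r) = a \<and> \<phi> (1, c) = b \<and> \<phi> (2, s) = \<sigma>}} \<le> 1"
proof -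
  define W where "W \<sigma> = {\<phi> \<in> homs n Q V P. \<phi> (0, r) = a \<and> \<phi> (1, c) = b \<and> \<phi> (2, s) = \<sigma>}" for \<sigma>
  define C where "C = {\<sigma> \<in> {1..n}. \<epsilon> * real n ^ k \<le> card (W \<sigma>)}"
  define \<theta> :: "nat \<times> nat \<Rightarrow> nat" where "\<theta> l = (if l = (0, r) then a else b)" for l
  have finW: "finite (W \<sigma>)" for \<sigma> using fin by (simp add: W_def)
  have "(\<Sum>\<sigma>\<in>C. card (W \<sigma>)) = card (\<Union>\<sigma>\<in>C. W \<sigma>)"
    by (rule card_UN_disjoint[symmetric]) (auto simp: C_def finW, auto simp: W_def)
  also have "\<dots> \<le> card {\<phi> \<in> homs n Q V P. \<forall>l\<in>{(0, r), (1, c)}. \<phi> l = \<theta> l}"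
    using fin by (intro card_mono) (auto simp: W_def \<theta>_def)
  also have "\<dots> \<le> n ^ (card V - (card {(0::nat, r), (1, c)} + card P))"
    using V by (intro card_homs_rooted_le(2) fin deg Q) auto
  also have "\<dots> = n ^ k" using k by simp
  finally have s: "(\<Sum>\<sigma>\<in>C. card (W \<sigma>)) \<le> n ^ k" .
  have "(\<Sum>\<sigma>\<in>C. \<epsilon> * real n ^ k) \<le> (\<Sum>\<sigma>\<in>C. real (card (W \<sigma>)))"
    by (intro sum_mono) (simp add: C_def)
  also have "\<dots> \<le> real n ^ k"
    using s unfolding of_nat_power[symmetric] of_nat_sum[symmetric] of_nat_le_iff .
  finally have "(\<epsilon> * card C) * real n ^ k \<le> 1 * real n ^ k" by (simp add: mult_ac)
  then have "\<epsilon> * card C \<le> 1" using n by (simp only: mult_le_cancel_right) (simp add: not_less)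
  then show ?thesis unfolding C_def W_def .
qed

text \<open>The encoding applied to \<open>symbol_at\<close>: \<open>closed_embs_predict\<close>
  provides the predictable cells, \<open>card_heavy_values_le\<close> the bound on their
  candidates.\<close>

lemma card_closed_embs_le:
  fixes \<epsilon> :: real
  assumes fin: "finite V" "finite P" and V: "lines_of P \<subseteq> V" "(0, r) \<in> V" "(1, c) \<in> V" "(2, s) \<in> V"
    and cell: "\<And>t. (r, c, t) \<notin> P" and deg: "degenerate {(0, r), (1, c)} P"
    and k: "card V = k + 2 + card P" and \<epsilon>: "\<epsilon> > 0" and K: "1 / \<epsilon> \<le> K" "1 \<le> K" "K \<le> n"
  shows "card {L. latin_square n L \<and>
      2 ^ (card P + 2) * \<epsilon> * real n ^ (k + 2) \<le> card (closed_embs n L V P (r, c, s))}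
    \<le> 4 ^ (n * n) * (real n ^ (n * n) * (real K / n) powr (\<epsilon> * real (n * n)))"
proof -
  let ?U = "{1..n} \<times> {1..n}"
  define Bad where "Bad = {L. latin_square n L \<and>
      2 ^ (card P + 2) * \<epsilon> * real n ^ (k + 2) \<le> card (closed_embs n L V P (r, c, s))}"
  \<comment> \<open>Rebuilds the entries in the cells of \<open>T\<close> from their symbols, as the
    decoder does.\<close>
  define q where "q T h = {(a, b, h (a, b)) | a b. (a, b) \<in> T}" for T and h :: "nat \<times> nat \<Rightarrow> nat"
  define C where "C T h x = {\<sigma> \<in> {1..n}. \<epsilon> * real n ^ k \<le>
    card {\<phi> \<in> homs n (q T h) V P. \<phi> (0, r) = fst x \<and> \<phi> (1, c) = snd x \<and> \<phi> (2, s) = \<sigma>}}" for T h x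
  \<comment> \<open>The encoding requires at most \<open>K\<close> candidates for arbitrary
    \<open>T\<close> and \<open>h\<close>. The cutoff ensures this also where \<open>q T h\<close>
    is not a partial Latin square; for genuine data it changes nothing.\<close>
  define cand where "cand T h x = (if card (C T h x) \<le> K then C T h x else {})" for T h x
  have n: "n > 0" using K by simp
  have inj: "inj_on (symbol_at n) Bad"
    by (rule inj_on_subset[OF inj_on_symbol_at]) (auto simp: Bad_def)
  have "real (card (symbol_at n ` Bad)) \<le>
      4 ^ card ?U * (real n ^ card ?U * (real K / n) powr (\<epsilon> * card ?U))"
  proof (rule card_predictable_functions_le[where A = "{1..n}" and cand = cand])
    show "finite (cand T h x)" "card (cand T h x) \<le> K" for T h x
      by (simp_all add: cand_def C_def)
  next
    fix f assume "f \<in> symbol_at n ` Bad"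
    then obtain L where L: "L \<in> Bad" and f: "f = symbol_at n L" by blast
    have Ls: "latin_square n L" using L by (simp add: Bad_def)
    have Lp: "partial_latin_square n L" using Ls by (simp add: latin_square_def)
    have fU: "f x \<in> {1..n}" if "x \<in> ?U" for x
    proof -
      obtain a b where x: "x = (a, b)" by fastforce
      have "(a, b, symbol_at n L (a, b)) \<in> L" using that symbol_at[OF Ls] by (simp add: x)
      then show ?thesis using partial_latin_squareD(1)[OF Lp] by (simp add: x f)
    qed
    show "f \<in> ?U \<rightarrow>\<^sub>E {1..n}"
    proof (rule PiE_I)
      show "f x = undefined" if "x \<notin> ?U" for x using that unfolding f symbol_at_def restrict_def by (rule if_not_P)
    qed (rule fU)
    have "2 ^ (card P + 2) * \<epsilon> * real n ^ (k + 2) \<le> card (closed_embs n L V P (r, c, s))"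
      using L by (simp add: Bad_def)
    from closed_embs_predict[OF fin V cell deg k \<epsilon> n Ls this]
    obtain T X where TX: "X \<subseteq> ?U" "T \<subseteq> ?U - X" "\<epsilon> * card ?U \<le> card X"
      "\<And>x. x \<in> X \<Longrightarrow> \<epsilon> * real n ^ k \<le> card {\<phi> \<in> homs n {e \<in> L. (fst e, fst (snd e)) \<in> T} V P.
      \<phi> (0, r) = fst x \<and> \<phi> (1, c) = snd x \<and> \<phi> (2, s) = symbol_at n L x}" 
      by (elim exE conjE) (rule that, assumption+, erule bspec)
    have q: "q T (restrict f T) = {e \<in> L. (fst e, fst (snd e)) \<in> T}"
    proof -
      have e: "(a, b, t) \<in> q T (restrict f T) \<longleftrightarrow> (a, b, t) \<in> {e \<in> L. (fst e, fst (snd e)) \<in> T}" for a b t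
        using TX(2) by (auto simp: q_def f symbol_at[OF Ls])
      show ?thesis
      proof (rule set_eqI)
        fix x show "x \<in> q T (restrict f T) \<longleftrightarrow> x \<in> {e \<in> L. (fst e, fst (snd e)) \<in> T}"
          by (cases x) (simp only: e)
      qed
    qed
    have Qp: "partial_latin_square n (q T (restrict f T))"
      unfolding q by (rule partial_latin_square_subset[OF Lp]) auto
    have "f x \<in> cand T (restrict f T) x" if x: "x \<in> X" for x
    proof -
      have "\<epsilon> * card (C T (restrict f T) x) \<le> 1"
        unfolding C_def by (rule card_heavy_values_le[OF fin V(1-3) deg k \<epsilon> n Qp])
      then have "card (C T (restrict f T) x) \<le> 1 / \<epsilon>" using \<epsilon> by (simp add: field_simps)
      then have "card (C T (restrict f T) x) \<le> K" using K(1) by linarith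
      moreover have "f x \<in> {1..n}" using fU TX(1) x by blast
      then have "f x \<in> C T (restrict f T) x" unfolding C_def q using TX(4)[OF x] by (simp add: f)
      ultimately show ?thesis by (simp add: cand_def)
    qed
    then show "\<exists>T X. X \<subseteq> ?U \<and> T \<subseteq> ?U - X \<and> \<epsilon> * card ?U \<le> card X \<and> (\<forall>x\<in>X. f x \<in> cand T (restrict f T) x)"
      using TX(1-3) by blast
  qed (use K in auto)
  then show ?thesis using card_image[OF inj] by (simp add: Bad_def)
qed

lemma closed_embs_rare:
  fixes \<epsilon> :: real
  assumes fin: "finite V" "finite P" and V: "lines_of P \<subseteq> V" "(0, r) \<in> V" "(1, c) \<in> V" "(2, s) \<in> V"
    and cell: "\<And>t. (r, c, t) \<notin> P" and deg: "degenerate {(0, r), (1, c)} P" and \<epsilon>: "\<epsilon> > 0"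
  shows "(\<lambda>n. real (card {L. latin_square n L \<and>
      \<epsilon> * real n ^ (card V - card P) \<le> card (closed_embs n L V P (r, c, s))}) / card {L. latin_square n L}) \<longlonglongrightarrow> 0"
proof -
  have "card {(0::nat, r), (1, c)} + card P \<le> card V"
    using V by (intro card_homs_rooted_le(1)[where Q = "{}" and n = 0] fin deg) (auto simp: partial_latin_square_def)
  then have "\<exists>k. card V = k + 2 + card P" by (intro exI[of _ "card V - (2 + card P)"]) simp
  then obtain k where k: "card V = k + 2 + card P" by blast
  define \<delta> where "\<delta> = \<epsilon> / 2 ^ (card P + 2)"
  have \<delta>: "\<delta> > 0" using \<epsilon> by (simp add: \<delta>_def)
  define K where "K = nat \<lceil>1 / \<delta>\<rceil> + 1"
  have K: "1 / \<delta> \<le> K" "1 \<le> K" unfolding K_def by linarith+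
  define B where "B n = {L. latin_square n L \<and>
      \<epsilon> * real n ^ (card V - card P) \<le> card (closed_embs n L V P (r, c, s))}" for n
  \<comment> \<open>The proportion of bad squares, per cell: 4 for naming \<open>T\<close> and
    \<open>X\<close>, exp 2 from the lower bound on the number of Latin squares, and the saving of
    the encoding, which makes it tend to 0.\<close>
  define x where "x n = 4 * exp 2 * (real K / real n) powr \<delta>" for n
  have bound: "real (card (B n)) / card {L. latin_square n L} \<le> x n ^ (n * n)" if n: "n \<ge> K" for n
  proof -
    have n0: "real n > 0" using n K by simp
    have N: "card {L. latin_square n L} > 0"
      using latin_squares_nonempty[of n] finite_latin_squares[of n] by (simp only: card_gt_0_iff not_False_eq_True simp_thms)
    have Beq: "B n = {L. latin_square n L \<and>
      2 ^ (card P + 2) * \<delta> * real n ^ (k + 2) \<le> card (closed_embs n L V P (r, c, s))}"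
      using k by (simp add: B_def \<delta>_def)
    have "real (card (B n)) \<le> 4 ^ (n * n) * (real n ^ (n * n) * (real K / n) powr (\<delta> * real (n * n)))"
      unfolding Beq using card_closed_embs_le[OF fin V cell deg k \<delta> K n] .
    also have "(real K / n) powr (\<delta> * real (n * n)) = ((real K / n) powr \<delta>) ^ (n * n)"
      using n0 K by (simp add: powr_powr[symmetric] powr_realpow power_mult)
    also have "4 ^ (n * n) * (real n ^ (n * n) * ((real K / n) powr \<delta>) ^ (n * n)) = x n ^ (n * n) * (real n / exp 2) ^ (n * n)"
    proof -
      have "4 * (real n * (real K / n) powr \<delta>) = x n * (real n / exp 2)" by (simp add: x_def)
      then show ?thesis unfolding power_mult_distrib[symmetric] by (rule arg_cong)
    qed
    also have "\<dots> \<le> x n ^ (n * n) * card {L. latin_square n L}"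
      by (intro mult_left_mono card_latin_squares_ge) (simp add: x_def)
    finally show ?thesis
      using N by (simp add: divide_le_eq)
  qed
  have "(\<lambda>n. real K / real n) \<longlonglongrightarrow> 0"
    by (rule tendsto_divide_0[OF tendsto_const]) (rule filterlim_at_top_imp_at_infinity[OF filterlim_real_sequentially])
  then have "x \<longlonglongrightarrow> 4 * exp 2 * 0"
    unfolding x_def by (intro tendsto_mult tendsto_const tendsto_zero_powrI[where b = \<delta>] \<delta>) auto
  then have "eventually (\<lambda>n. x n < 1 / 2) sequentially"
    by (intro order_tendstoD) auto
  then have ev: "eventually (\<lambda>n. real (card (B n)) / card {L. latin_square n L} \<le> (1 / 2) ^ n) sequentially"
    using eventually_ge_at_top[of K]
  proof eventually_elim
    case (elim n)
    have "real (card (B n)) / card {L. latin_square n L} \<le> x n ^ (n * n)" by (rule bound) fact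
    also have "\<dots> \<le> (1 / 2) ^ (n * n)" using elim by (intro power_mono) (auto simp: x_def)
    also have "\<dots> \<le> (1 / 2) ^ n" by (rule power_decreasing) auto
    finally show ?case .
  qed
  have "(\<lambda>n. real (card (B n)) / card {L. latin_square n L}) \<longlonglongrightarrow> 0"
  proof (rule tendsto_sandwich[OF _ ev tendsto_const])
    show "(\<lambda>n. (1 / 2 :: real) ^ n) \<longlonglongrightarrow> 0" by (rule LIMSEQ_power_zero) simp
  qed simp
  then show ?thesis unfolding B_def .
qed

section \<open>Counting embeddings\<close>

text \<open>The reference order is that of \<open>card_homs_rooted_le\<close>: one free line is lost
  for each entry.\<close>

definition few_embs :: "nat \<Rightarrow> real \<Rightarrow> (nat \<times> nat) set \<Rightarrow> entry set \<Rightarrow> entry set set" where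
  "few_embs n \<epsilon> V P = {L. latin_square n L \<and> card (embs n L V P) < (1 - \<epsilon>) * real n ^ (card V - card P)}"

text \<open>All \<epsilon> at once, because the induction step passes from \<epsilon> to \<epsilon>
  / 2.\<close>

definition abundant :: "(nat \<times> nat) set \<Rightarrow> entry set \<Rightarrow> bool" where
  "abundant V P \<longleftrightarrow> (\<forall>\<epsilon>>0. (\<lambda>n. real (card (few_embs n \<epsilon> V P)) / card {L. latin_square n L}) \<longlonglongrightarrow> 0)"

lemma card_PiE_collision_le:
  assumes "finite V" "l \<in> V" "l' \<in> V" "l \<noteq> l'"
  shows "card {\<phi> \<in> V \<rightarrow>\<^sub>E {1..n}. \<phi> l = \<phi> l'} \<le> n ^ (card V - 1)"
proof -
  have "inj_on (\<lambda>\<phi>. restrict \<phi> (V - {l})) {\<phi> \<in> V \<rightarrow>\<^sub>E {1..n}. \<phi> l = \<phi> l'}"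
  proof (rule inj_onI)
    fix \<phi> \<psi> assume h: "\<phi> \<in> {\<phi> \<in> V \<rightarrow>\<^sub>E {1..n}. \<phi> l = \<phi> l'}" "\<psi> \<in> {\<phi> \<in> V \<rightarrow>\<^sub>E {1..n}. \<phi> l = \<phi> l'}"
      "restrict \<phi> (V - {l}) = restrict \<psi> (V - {l})"
    have eq: "\<phi> x = \<psi> x" if "x \<in> V" "x \<noteq> l" for x using fun_cong[OF h(3), of x] that by simp
    show "\<phi> = \<psi>"
    proof (rule extensionalityI)
      show "\<phi> \<in> extensional V" "\<psi> \<in> extensional V" using h by (auto simp: PiE_def)
      show "\<phi> x = \<psi> x" if "x \<in> V" for x
        using eq[of x] eq[of l'] assms h that by (cases "x = l") auto
    qed
  qed
  moreover have "(\<lambda>\<phi>. restrict \<phi> (V - {l})) ` {\<phi> \<in> V \<rightarrow>\<^sub>E {1..n}. \<phi> l = \<phi> l'} \<subseteq> (V - {l}) \<rightarrow>\<^sub>E {1..n}"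
    by (auto simp: PiE_iff split: if_splits simp del: atLeastAtMost_iff)
  ultimately have "card {\<phi> \<in> V \<rightarrow>\<^sub>E {1..n}. \<phi> l = \<phi> l'} \<le> card ((V - {l}) \<rightarrow>\<^sub>E {1..n})"
    using assms(1) by (intro card_inj_on_le) (auto intro: finite_PiE)
  also have "\<dots> = n ^ (card V - 1)" using assms by (simp add: card_PiE)
  finally show ?thesis .
qed

text \<open>Without entries a map fails to be an embedding only by a collision, and each pair of
  lines collides in at most n ^ (v - 1) of the n ^ v maps. Hence no square at all is exceptional
  once n is large.\<close>

lemma abundant_empty:
  assumes fin: "finite V"
  shows "abundant V {}"
  unfolding abundant_def
proof (intro allI impI)
  fix \<epsilon> :: real assume \<epsilon>: "\<epsilon> > 0"
  let ?I = "{(l, l'). l \<in> V \<and> l' \<in> V \<and> l \<noteq> l'}"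
  have finI: "finite ?I" by (rule finite_subset[of _ "V \<times> V"]) (use fin in auto)
  have "few_embs n \<epsilon> V {} = {}" if n: "real n > card ?I / \<epsilon>" for n
  proof (rule ccontr)
    assume "few_embs n \<epsilon> V {} \<noteq> {}"
    then obtain L where L: "card (embs n L V {}) < (1 - \<epsilon>) * real n ^ card V" by (auto simp: few_embs_def)
    have n0: "real n > 0" using n \<epsilon> by (meson divide_nonneg_pos le_less_trans of_nat_0_le_iff)
    have "V \<rightarrow>\<^sub>E {1..n} \<subseteq> embs n L V {} \<union> (\<Union>(l, l')\<in>?I. {\<phi> \<in> V \<rightarrow>\<^sub>E {1..n}. \<phi> l = \<phi> l'})"
      by (auto simp: embs_def homs_def)
    then have "card (V \<rightarrow>\<^sub>E {1..n}) \<le> card (embs n L V {} \<union> (\<Union>(l, l')\<in>?I. {\<phi> \<in> V \<rightarrow>\<^sub>E {1..n}. \<phi> l = \<phi> l'}))"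
      using fin finI by (intro card_mono) (auto intro!: finite_PiE)
    also have "\<dots> \<le> card (embs n L V {}) + card (\<Union>(l, l')\<in>?I. {\<phi> \<in> V \<rightarrow>\<^sub>E {1..n}. \<phi> l = \<phi> l'})"
      by (rule card_Un_le)
    also have "card (\<Union>(l, l')\<in>?I. {\<phi> \<in> V \<rightarrow>\<^sub>E {1..n}. \<phi> l = \<phi> l'}) \<le> (\<Sum>p\<in>?I. n ^ (card V - 1))"
    proof (rule order_trans[OF card_UN_le[OF finI] sum_mono])
      fix p assume "p \<in> ?I"
      then obtain l l' where p: "p = (l, l')" and l: "l \<in> V" "l' \<in> V" "l \<noteq> l'" by blast
      show "card (case p of (l, l') \<Rightarrow> {\<phi> \<in> V \<rightarrow>\<^sub>E {1..n}. \<phi> l = \<phi> l'}) \<le> n ^ (card V - 1)"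
        unfolding p case_prod_conv by (rule card_PiE_collision_le[OF fin l])
    qed
    finally have "n ^ card V \<le> card (embs n L V {}) + card ?I * n ^ (card V - 1)"
      using fin by (simp add: card_PiE)
    then have "real (n ^ card V) \<le> real (card (embs n L V {}) + card ?I * n ^ (card V - 1))"
      by (simp only: of_nat_le_iff)
    then have le: "real n ^ card V \<le> card (embs n L V {}) + card ?I * real n ^ (card V - 1)" by simp
    have "card ?I * real n ^ (card V - 1) \<le> \<epsilon> * real n ^ card V"
    \<comment> \<open>For empty \<open>V\<close> the exponent \<open>card V - 1\<close> is
      truncated, but then there are no pairs.\<close>
    proof (cases "V = {}")
      case False
      then have "card V = Suc (card V - 1)" using fin by (simp add: card_gt_0_iff Suc_diff_1)
      then have e: "real n ^ card V = real n * real n ^ (card V - 1)" by (metis power_Suc)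
      have "card ?I \<le> \<epsilon> * real n" using n \<epsilon> by (simp add: field_simps)
      then show ?thesis unfolding e using n0 by (simp add: mult.assoc[symmetric] mult_right_mono)
    next
      case True
      then show ?thesis using \<epsilon> by simp
    qed
    then show False using L le by (simp add: algebra_simps)
  qed
  moreover have "eventually (\<lambda>n. real n > card ?I / \<epsilon>) sequentially"
    using filterlim_real_sequentially unfolding filterlim_at_top_dense by blast
  ultimately have "eventually (\<lambda>n. real (card (few_embs n \<epsilon> V {})) / card {L. latin_square n L} = 0) sequentially"
    by (elim eventually_mono) simp
  then show "(\<lambda>n. real (card (few_embs n \<epsilon> V {})) / card {L. latin_square n L}) \<longlonglongrightarrow> 0"
    by (rule tendsto_eventually)
qed

text \<open>An embedding of \<open>P'\<close> extends to the symbol of the cell of \<open>(r, c, s)\<close> unless it is closed.\<close>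

lemma embs_extend:
  assumes fin: "finite V" and V: "lines_of P \<subseteq> V" and g: "(r, c, s) \<in> P"
    and new: "(2, s) \<notin> lines_of (P - {(r, c, s)})" and L: "latin_square n L"
  defines "V' \<equiv> V - {(2, s)}" and "P' \<equiv> P - {(r, c, s)}"
  shows "card (embs n L V' P') \<le>
    card (embs n L V P) + (\<Sum>l\<in>{l \<in> V'. fst l = 2}. card (closed_embs n L V' P' (r, c, snd l)))"
proof -
  let ?I = "{l \<in> V'. fst l = 2}"
  have finV': "finite V'" using fin by (simp add: V'_def)
  have Vg: "(0, r) \<in> V'" "(1, c) \<in> V'" "(2, s) \<in> V"
    using lines_ofI[OF g, of 0] lines_ofI[OF g, of 1] lines_ofI[OF g, of 2] V by (auto simp: coord_def V'_def)
  have sub: "lines_of P' \<subseteq> V'" using lines_of_mono[of P' P] V new by (auto simp: P'_def V'_def)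
  have "embs n L V' P' \<subseteq> (\<lambda>\<phi>. restrict \<phi> V') ` embs n L V P \<union> (\<Union>l\<in>?I. closed_embs n L V' P' (r, c, snd l))"
  proof
    fix \<phi> assume \<phi>: "\<phi> \<in> embs n L V' P'"
    show "\<phi> \<in> (\<lambda>\<phi>. restrict \<phi> V') ` embs n L V P \<union> (\<Union>l\<in>?I. closed_embs n L V' P' (r, c, snd l))"
    proof (rule ccontr)
      assume no: "\<not> ?thesis"
      have \<phi>V: "\<phi> \<in> V' \<rightarrow>\<^sub>E {1..n}" and \<phi>P: "\<And>e. e \<in> P' \<Longrightarrow> map_entry \<phi> e \<in> L"
        and \<phi>i: "\<And>l l'. l \<in> V' \<Longrightarrow> l' \<in> V' \<Longrightarrow> fst l = fst l' \<Longrightarrow> \<phi> l = \<phi> l' \<Longrightarrow> l = l'"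
        using \<phi> unfolding embs_def homs_def by blast+
      define z where "z = symbol_at n L (\<phi> (0, r), \<phi> (1, c))"
      have "\<phi> (0, r) \<in> {1..n}" "\<phi> (1, c) \<in> {1..n}" using \<phi>V Vg by blast+
      then have zL: "(\<phi> (0, r), \<phi> (1, c), z) \<in> L" using symbol_at[OF L] by (simp add: z_def)
      then have z: "z \<in> {1..n}" using L partial_latin_squareD(1) unfolding latin_square_def by blast
      define \<psi> where "\<psi> = \<phi>((2, s) := z)"
      have zc: "\<phi> l \<noteq> z" if l: "l \<in> V'" "fst l = 2" for l
      proof
        assume "\<phi> l = z"
        moreover have "l = (2, snd l)" using l by (cases l) simp
        ultimately have "map_entry \<phi> (r, c, snd l) \<in> L" using zL by (simp add: map_entry_def)
        then have "\<phi> \<in> closed_embs n L V' P' (r, c, snd l)" using \<phi> by (simp add: closed_embs_def)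
        then show False using no l by blast
      qed
      have eV: "\<psi> l = \<phi> l" if "l \<in> V'" for l using that by (auto simp: \<psi>_def V'_def)
      have "\<psi> \<in> V \<rightarrow>\<^sub>E {1..n}"
      proof (rule PiE_I)
        fix l assume "l \<in> V"
        then show "\<psi> l \<in> {1..n}"
          using z PiE_mem[OF \<phi>V, of l] eV[of l] by (cases "l = (2, s)") (simp_all add: \<psi>_def V'_def)
      next
        fix l assume "l \<notin> V"
        then have "l \<noteq> (2, s)" "l \<notin> V'" using Vg by (auto simp: V'_def)
        then show "\<psi> l = undefined" using PiE_arb[OF \<phi>V] by (simp add: \<psi>_def)
      qed
      moreover have "map_entry \<psi> e \<in> L" if "e \<in> P" for e
      proof (cases "e = (r, c, s)")
        case True
        then show ?thesis using zL by (simp add: map_entry_def \<psi>_def)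
      next
        case False
        then have e: "e \<in> P'" using that by (simp add: P'_def)
        have "map_entry \<psi> e = map_entry \<phi> e"
        proof (rule entry_eqI)
          fix i :: nat assume i: "i < 3"
          have "(i, coord i e) \<in> V'" using lines_ofI[OF e i] sub by blast
          then show "coord i (map_entry \<psi> e) = coord i (map_entry \<phi> e)"
            unfolding coord_map_entry[OF i] by (rule eV)
        qed
        then show ?thesis using \<phi>P[OF e] by simp
      qed
      moreover have "l = l'" if l: "l \<in> V" "l' \<in> V" "fst l = fst l'" "\<psi> l = \<psi> l'" for l l'
      proof -
        have V: "x \<in> V'" if "x \<in> V" "x \<noteq> (2, s)" for x using that by (simp add: V'_def)
        have zz: "\<psi> (2, s) = z" by (simp add: \<psi>_def)
        consider "l = (2, s)" "l' = (2, s)" | "l = (2, s)" "l' \<noteq> (2, s)" | "l \<noteq> (2, s)" "l' = (2, s)"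
          | "l \<noteq> (2, s)" "l' \<noteq> (2, s)" by blast
        then show ?thesis
        proof cases
          case 2
          then show ?thesis using zc[of l'] V[of l'] eV[of l'] l zz by simp
        next
          case 3
          then show ?thesis using zc[of l] V[of l] eV[of l] l zz by simp
        next
          case 4
          then show ?thesis using \<phi>i[of l l'] V[of l] V[of l'] eV[of l] eV[of l'] l by simp
        qed simp
      qed
      ultimately have "\<psi> \<in> embs n L V P" unfolding embs_def homs_def by blast
      moreover have "restrict \<psi> V' = \<phi>"
      proof (rule extensionalityI)
        show "\<phi> \<in> extensional V'" using \<phi>V by (simp add: PiE_def)
      qed (use eV in auto)
      ultimately show False using no by blast
    qed
  qed
  then have "card (embs n L V' P') \<le> card ((\<lambda>\<phi>. restrict \<phi> V') ` embs n L V P \<union> (\<Union>l\<in>?I. closed_embs n L V' P' (r, c, snd l)))"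
    using fin finV' by (intro card_mono) (auto simp: closed_embs_def)
  also have "\<dots> \<le> card ((\<lambda>\<phi>. restrict \<phi> V') ` embs n L V P) + card (\<Union>l\<in>?I. closed_embs n L V' P' (r, c, snd l))"
    by (rule card_Un_le)
  also have "\<dots> \<le> card (embs n L V P) + (\<Sum>l\<in>?I. card (closed_embs n L V' P' (r, c, snd l)))"
    using fin finV' by (intro add_mono card_image_le card_UN_le) auto
  finally show ?thesis .
qed

text \<open>Restoring \<open>g\<close> costs only the embeddings of the rest that are closed at the
  cell of \<open>g\<close> for a symbol line already in \<open>V'\<close>. These lines are fixed in
  number, and \<open>closed_embs_rare\<close> applies to each of them.\<close>

lemma abundant_step:
  assumes fin: "finite V" "finite P" and V: "lines_of P \<subseteq> V" and g: "g \<in> P"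
    and new: "(2, coord 2 g) \<notin> lines_of (P - {g})" and sp: "sparse_entries P" and P: "partial_latin_square n\<^sub>0 P"
    and ab: "abundant (V - {(2, coord 2 g)}) (P - {g})"
  shows "abundant V P"
  unfolding abundant_def
proof (intro allI impI)
  fix \<epsilon> :: real assume \<epsilon>: "\<epsilon> > 0"
  obtain r c s where grcs: "g = (r, c, s)" by (metis prod_cases3)
  have s: "coord 2 g = s" by (simp add: grcs coord_def)
  define V' where "V' = V - {(2, s)}"
  define P' where "P' = P - {g}"
  define I where "I = {l \<in> V'. fst l = 2}"
  \<comment> \<open>Half of \<epsilon> goes to the induction hypothesis; the other half is shared by
    the symbol lines in \<open>I\<close>, and the + 1 covers empty \<open>I\<close>.\<close>
  define \<delta> where "\<delta> = \<epsilon> / (2 * (card I + 1))"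
  have \<delta>: "\<delta> > 0" using \<epsilon> by (simp add: \<delta>_def)
  have finV': "finite V'" "finite P'" using fin by (simp_all add: V'_def P'_def)
  have finI: "finite I" using finV' by (simp add: I_def)
  have Vg: "(0, r) \<in> V'" "(1, c) \<in> V'" "(2, s) \<in> V"
    using lines_ofI[OF g, of 0] lines_ofI[OF g, of 1] lines_ofI[OF g, of 2] V by (auto simp: coord_def V'_def grcs)
  have sub: "lines_of P' \<subseteq> V'" using lines_of_mono[of P' P] V new by (auto simp: P'_def V'_def s)
  have "card V = Suc (card V')" "card P = Suc (card P')"
    unfolding V'_def P'_def using fin Vg g by (simp_all only: card_Suc_Diff1)
  then have d: "card V - card P = card V' - card P'" by simp
  have cell: "(r, c, t) \<notin> P'" for t
    using partial_latin_squareD(2)[OF P, of r c t s] g by (auto simp: P'_def grcs)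
  \<comment> \<open>The root is the cell of \<open>g\<close>: a line that avoids all lines of
    \<open>g\<close> avoids its row and its column in particular.\<close>
  have deg: "degenerate {(0, r), (1, c)} P'"
    unfolding degenerate_def
  proof (intro allI impI)
    fix F assume F: "F \<subseteq> P'" "F \<noteq> {}"
    have "sparse_entries (insert g F)" by (rule sparse_subset[OF sp]) (use F g in \<open>auto simp: P'_def\<close>)
    moreover have "finite F" "g \<notin> F" using F(1) finV' finite_subset by (auto simp: P'_def)
    ultimately obtain h i where h: "h \<in> F" "i < 3" "(i, coord i h) \<notin> lines_of (insert g (F - {h}))"
      using sparse_degenerate_rooted[of g F] F(2) by blast
    moreover have "{(0, r), (1, c)} \<union> lines_of (F - {h}) \<subseteq> lines_of (insert g (F - {h}))"
      using lines_ofI[of g "insert g (F - {h})" 0] lines_ofI[of g "insert g (F - {h})" 1]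
        lines_of_mono[of "F - {h}" "insert g (F - {h})"] by (auto simp: coord_def grcs)
    ultimately show "\<exists>g\<in>F. \<exists>i<3. (i, coord i g) \<notin> {(0, r), (1, c)} \<union> lines_of (F - {g})" by blast
  qed
  define C where "C n l = {L. latin_square n L \<and>
    \<delta> * real n ^ (card V' - card P') \<le> card (closed_embs n L V' P' (r, c, snd l))}" for n and l :: "nat \<times> nat"
  have C0: "(\<lambda>n. real (card (C n l)) / card {L. latin_square n L}) \<longlonglongrightarrow> 0" if "l \<in> I" for l
  proof -
    have "(2, snd l) \<in> V'" using that by (cases l) (simp add: I_def)
    then show ?thesis unfolding C_def
      by (intro closed_embs_rare finV' sub Vg cell deg \<delta>)
  qed
  have sub2: "few_embs n \<epsilon> V P \<subseteq> few_embs n (\<epsilon> / 2) V' P' \<union> (\<Union>l\<in>I. C n l)" for n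
  proof
    fix L assume L: "L \<in> few_embs n \<epsilon> V P"
    have Ls: "latin_square n L" using L by (simp add: few_embs_def)
    define N where "N = real n ^ (card V' - card P')"
    have N: "N \<ge> 0" by (simp add: N_def)
    show "L \<in> few_embs n (\<epsilon> / 2) V' P' \<union> (\<Union>l\<in>I. C n l)"
    proof (rule ccontr)
      assume no: "\<not> ?thesis"
      have 1: "(1 - \<epsilon> / 2) * N \<le> card (embs n L V' P')"
        using no Ls by (simp add: few_embs_def N_def)
      have 2: "card (closed_embs n L V' P' (r, c, snd l)) \<le> \<delta> * N" if "l \<in> I" for l
        using no Ls that by (auto simp: C_def N_def)
      have "card (embs n L V' P') \<le> card (embs n L V P) + (\<Sum>l\<in>I. card (closed_embs n L V' P' (r, c, snd l)))"
        using embs_extend[OF fin(1) V, of r c s n L] g new Ls unfolding I_def V'_def P'_def grcs s by (simp add: coord_def)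
      then have "real (card (embs n L V' P')) \<le>
          real (card (embs n L V P) + (\<Sum>l\<in>I. card (closed_embs n L V' P' (r, c, snd l))))"
        by (simp only: of_nat_le_iff)
      also have "\<dots> \<le> card (embs n L V P) + (\<Sum>l\<in>I. \<delta> * N)"
        unfolding of_nat_add of_nat_sum using 2 by (intro add_left_mono sum_mono)
      also have "(\<Sum>l\<in>I. \<delta> * N) = (card I * \<delta>) * N" by simp
      also have "\<dots> \<le> (\<epsilon> / 2) * N"
        using \<epsilon> by (intro mult_right_mono N) (simp add: \<delta>_def field_simps)
      finally have "(1 - \<epsilon> / 2) * N \<le> card (embs n L V P) + (\<epsilon> / 2) * N" using 1 by simp
      then have "(1 - \<epsilon>) * N \<le> card (embs n L V P)" by (simp add: algebra_simps)
      then show False using L by (simp add: few_embs_def d N_def)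
    qed
  qed
  have finL: "finite {L. latin_square n L \<and> X L}" for n X
    by (rule finite_subset[OF _ finite_latin_squares[of n]]) auto
  have le: "real (card (few_embs n \<epsilon> V P)) / card {L. latin_square n L}
    \<le> real (card (few_embs n (\<epsilon> / 2) V' P')) / card {L. latin_square n L}
      + (\<Sum>l\<in>I. real (card (C n l)) / card {L. latin_square n L})" for n
  proof -
    have "card (few_embs n \<epsilon> V P) \<le> card (few_embs n (\<epsilon> / 2) V' P' \<union> (\<Union>l\<in>I. C n l))"
      using finI finL by (intro card_mono sub2) (auto simp: few_embs_def C_def)
    also have "\<dots> \<le> card (few_embs n (\<epsilon> / 2) V' P') + card (\<Union>l\<in>I. C n l)" by (rule card_Un_le)
    also have "\<dots> \<le> card (few_embs n (\<epsilon> / 2) V' P') + (\<Sum>l\<in>I. card (C n l))"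
      by (intro add_left_mono card_UN_le finI)
    finally have "real (card (few_embs n \<epsilon> V P)) \<le> real (card (few_embs n (\<epsilon> / 2) V' P') + (\<Sum>l\<in>I. card (C n l)))"
      by (simp only: of_nat_le_iff)
    then have "real (card (few_embs n \<epsilon> V P)) / card {L. latin_square n L} \<le>
      real (card (few_embs n (\<epsilon> / 2) V' P') + (\<Sum>l\<in>I. card (C n l))) / card {L. latin_square n L}"
      by (rule divide_right_mono) simp
    then show ?thesis by (simp add: add_divide_distrib sum_divide_distrib)
  qed
  have "(\<lambda>n. real (card (few_embs n (\<epsilon> / 2) V' P')) / card {L. latin_square n L}
      + (\<Sum>l\<in>I. real (card (C n l)) / card {L. latin_square n L})) \<longlonglongrightarrow> 0 + (\<Sum>l\<in>I. 0)"
  proof (intro tendsto_add tendsto_sum C0)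
    show "(\<lambda>n. real (card (few_embs n (\<epsilon> / 2) V' P')) / card {L. latin_square n L}) \<longlonglongrightarrow> 0"
      using ab[unfolded abundant_def, rule_format, of "\<epsilon> / 2"] \<epsilon> unfolding V'_def P'_def s by simp
  qed
  then have lim: "(\<lambda>n. real (card (few_embs n (\<epsilon> / 2) V' P')) / card {L. latin_square n L}
      + (\<Sum>l\<in>I. real (card (C n l)) / card {L. latin_square n L})) \<longlonglongrightarrow> 0" by simp
  show "(\<lambda>n. real (card (few_embs n \<epsilon> V P)) / card {L. latin_square n L}) \<longlonglongrightarrow> 0"
    by (rule tendsto_sandwich[OF always_eventually always_eventually tendsto_const lim]) (use le in auto)
qed

section \<open>Permuting the roles of rows, columns and symbols\<close>

text \<open>Exchanges type \<open>t\<close> with the symbols, so that the line forced by the other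
  two may always be taken to be a symbol; for \<open>t = 2\<close> it is the identity.\<close>

definition swap_tag :: "nat \<Rightarrow> nat \<times> nat \<Rightarrow> nat \<times> nat" where
  "swap_tag t = (\<lambda>(i, x). (Transposition.transpose t 2 i, x))"

definition swap_entry :: "nat \<Rightarrow> entry \<Rightarrow> entry" where
  "swap_entry t e = (coord (Transposition.transpose t 2 0) e, coord (Transposition.transpose t 2 1) e, coord (Transposition.transpose t 2 2) e)"

lemma coord_Pair: "coord i (r, c, s) = (if i = 0 then r else if i = 1 then c else s)"
  by (simp add: coord_def)

lemma transpose_less_3: "t < 3 \<Longrightarrow> i < 3 \<Longrightarrow> Transposition.transpose t 2 i < (3::nat)"
  by (auto simp: Transposition.transpose_def)

lemma coord_swap_entry: "i < 3 \<Longrightarrow> coord i (swap_entry t e) = coord (Transposition.transpose t 2 i) e"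
  unfolding less_3_cases swap_entry_def coord_Pair by auto

lemma swap_tag_involutive [simp]: "swap_tag t (swap_tag t l) = l"
  by (cases l) (simp add: swap_tag_def)

lemma swap_entry_involutive [simp]: "t < 3 \<Longrightarrow> swap_entry t (swap_entry t e) = e"
  by (rule entry_eqI) (simp add: coord_swap_entry transpose_less_3)

lemma swap_image_involutive [simp]:
  "swap_tag t ` swap_tag t ` V = V" "t < 3 \<Longrightarrow> swap_entry t ` swap_entry t ` P = P"
  by (simp_all add: image_image)

lemma inj_swap_tag: "inj (swap_tag t)"
  by (rule inj_on_inverseI[of _ "swap_tag t"]) simp

lemma inj_swap_entry: "t < 3 \<Longrightarrow> inj (swap_entry t)"
  by (rule inj_on_inverseI[of _ "swap_entry t"]) simp

lemma lines_of_swap: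
  assumes t: "t < 3"
  shows "lines_of (swap_entry t ` P) = swap_tag t ` lines_of P"
proof -
  have sub: "lines_of (swap_entry t ` P) \<subseteq> swap_tag t ` lines_of P" for P
  proof
    fix l assume "l \<in> lines_of (swap_entry t ` P)"
    then obtain e i where "e \<in> P" "i < 3" "l = (i, coord (Transposition.transpose t 2 i) e)"
      by (auto simp: lines_of_def coord_swap_entry)
    then have "l = swap_tag t (Transposition.transpose t 2 i, coord (Transposition.transpose t 2 i) e)"
      "(Transposition.transpose t 2 i, coord (Transposition.transpose t 2 i) e) \<in> lines_of P"
      using t by (auto simp: swap_tag_def transpose_less_3 intro: lines_ofI)
    then show "l \<in> swap_tag t ` lines_of P" by blast
  qed
  have "swap_tag t ` lines_of P = swap_tag t ` lines_of (swap_entry t ` swap_entry t ` P)" using t by simp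
  also have "\<dots> \<subseteq> swap_tag t ` swap_tag t ` lines_of (swap_entry t ` P)" by (intro image_mono sub)
  finally have "swap_tag t ` lines_of P \<subseteq> lines_of (swap_entry t ` P)" by simp
  then show ?thesis using sub[of P] by (rule equalityI[rotated])
qed

lemma sparse_swap:
  assumes t: "t < 3" and "sparse_entries P"
  shows "sparse_entries (swap_entry t ` P)"
  unfolding sparse_entries_def
proof (intro allI impI)
  fix F assume F: "F \<subseteq> swap_entry t ` P" "F \<noteq> {}"
  have G: "swap_entry t ` F \<subseteq> P" using image_mono[OF F(1), of "swap_entry t"] t by simp
  have "3 * card (swap_entry t ` F) < 2 * card (lines_of (swap_entry t ` F))"
    using assms(2) G F(2) unfolding sparse_entries_def by blast
  then show "3 * card F < 2 * card (lines_of F)"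
    unfolding lines_of_swap[OF t]
    using card_image[OF inj_on_subset[OF inj_swap_entry[OF t]], of F]
      card_image[OF inj_on_subset[OF inj_swap_tag], of "lines_of F" t] by simp
qed

lemma partial_latin_square_swap:
  assumes t: "t < 3" and P: "partial_latin_square n P"
  shows "partial_latin_square n (swap_entry t ` P)"
proof -
  have range: "coord i e \<in> {1..n}" if "e \<in> P" for i e
    using partial_latin_squareD(1)[OF P, of "fst e" "fst (snd e)" "snd (snd e)"] that
    by (auto simp: coord_def split: prod.splits)
  have eq: "x = y" if x: "x \<in> swap_entry t ` P" "y \<in> swap_entry t ` P" and i: "i < 3"
    and c: "\<And>j. j < 3 \<Longrightarrow> j \<noteq> i \<Longrightarrow> coord j x = coord j y" for x y i
  proof -
    obtain a b where ab: "a \<in> P" "b \<in> P" "x = swap_entry t a" "y = swap_entry t b" using x by blast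
    have "a = b"
    proof (rule partial_latin_square_unique[OF P ab(1,2), of "Transposition.transpose t 2 i"])
      show "Transposition.transpose t 2 i < 3" using t i by (rule transpose_less_3)
      fix j :: nat assume j: "j < 3" "j \<noteq> Transposition.transpose t 2 i"
      have "Transposition.transpose t 2 j \<noteq> i" using j(2) by (metis transpose_involutory)
      then show "coord j a = coord j b"
        using c[of "Transposition.transpose t 2 j"] j t by (simp add: ab coord_swap_entry transpose_less_3)
    qed
    then show ?thesis by (simp add: ab)
  qed
  show ?thesis
    unfolding partial_latin_square_def
  proof (intro conjI allI impI)
    show "swap_entry t ` P \<subseteq> {1..n} \<times> {1..n} \<times> {1..n}"
      using range unfolding swap_entry_def by blast
    show "s = s'" if "(r, c, s) \<in> swap_entry t ` P \<and> (r, c, s') \<in> swap_entry t ` P" for r c s s'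
      using eq[OF conjunct1[OF that] conjunct2[OF that], of 2] by (simp add: coord_Pair)
    show "c = c'" if "(r, c, s) \<in> swap_entry t ` P \<and> (r, c', s) \<in> swap_entry t ` P" for r c c' s
      using eq[OF conjunct1[OF that] conjunct2[OF that], of 1] by (simp add: coord_Pair)
    show "r = r'" if "(r, c, s) \<in> swap_entry t ` P \<and> (r', c, s) \<in> swap_entry t ` P" for r r' c s
      using eq[OF conjunct1[OF that] conjunct2[OF that], of 0] by (simp add: coord_Pair)
  qed
qed

text \<open>Being full is stated through cells and thus favours rows and columns; the number of
  entries is symmetric in the three roles.\<close>

lemma latin_square_iff_card:
  "latin_square n L \<longleftrightarrow> partial_latin_square n L \<and> card L = n * n"
proof -
  let ?p = "\<lambda>e :: entry. (fst e, fst (snd e))"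
  have "(\<forall>r\<in>{1..n}. \<forall>c\<in>{1..n}. \<exists>s. (r, c, s) \<in> L) \<longleftrightarrow> card L = n * n" if L: "partial_latin_square n L"
  proof -
    have inj: "inj_on ?p L"
      using partial_latin_squareD(2)[OF L] by (auto simp: inj_on_def)
    have sub: "?p ` L \<subseteq> {1..n} \<times> {1..n}" using partial_latin_squareD(1)[OF L] by force
    have "card L = n * n \<longleftrightarrow> card (?p ` L) = card ({1..n} \<times> {1..n})"
      using card_image[OF inj] by simp
    also have "\<dots> \<longleftrightarrow> ?p ` L = {1..n} \<times> {1..n}"
      using card_subset_eq[OF _ sub] by auto
    also have "\<dots> \<longleftrightarrow> {1..n} \<times> {1..n} \<subseteq> ?p ` L" using sub by blast
    also have "\<dots> \<longleftrightarrow> (\<forall>r\<in>{1..n}. \<forall>c\<in>{1..n}. \<exists>s. (r, c, s) \<in> L)" by (force simp: image_iff)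
    finally show ?thesis by simp
  qed
  then show ?thesis unfolding latin_square_def by blast
qed

lemma latin_square_swap: "t < 3 \<Longrightarrow> latin_square n L \<Longrightarrow> latin_square n (swap_entry t ` L)"
  using card_image[OF inj_on_subset[OF inj_swap_entry], of t L]
  by (simp add: latin_square_iff_card partial_latin_square_swap)

lemma map_entry_swap:
  assumes t: "t < 3"
  shows "map_entry (\<lambda>l. \<phi> (swap_tag t l)) e = swap_entry t (map_entry \<phi> (swap_entry t e))"
  by (rule entry_eqI) (simp add: coord_map_entry coord_swap_entry transpose_less_3 t swap_tag_def)

lemma card_embs_swap:
  assumes t: "t < 3"
  shows "card (embs n (swap_entry t ` L) (swap_tag t ` V) (swap_entry t ` P)) = card (embs n L V P)"
proof -
  define \<Theta> :: "(nat \<times> nat \<Rightarrow> nat) \<Rightarrow> nat \<times> nat \<Rightarrow> nat" where "\<Theta> \<phi> = (\<lambda>l. \<phi> (swap_tag t l))" for \<phi>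
  have map: "\<Theta> ` embs n L V P \<subseteq> embs n (swap_entry t ` L) (swap_tag t ` V) (swap_entry t ` P)" for L V P
  proof
    fix \<psi> assume "\<psi> \<in> \<Theta> ` embs n L V P"
    then obtain \<phi> where \<psi>: "\<psi> = \<Theta> \<phi>" and "\<phi> \<in> embs n L V P" by blast
    then have \<phi>: "\<phi> \<in> V \<rightarrow>\<^sub>E {1..n}" "map_entry \<phi> ` P \<subseteq> L"
      "\<And>l l'. l \<in> V \<Longrightarrow> l' \<in> V \<Longrightarrow> fst l = fst l' \<Longrightarrow> \<phi> l = \<phi> l' \<Longrightarrow> l = l'"
      by (simp_all add: embs_def homs_def)
    have "\<psi> \<in> swap_tag t ` V \<rightarrow>\<^sub>E {1..n}"
    proof (rule PiE_I)
      fix l assume "l \<in> swap_tag t ` V"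
      then have "swap_tag t l \<in> V" by auto
      then show "\<psi> l \<in> {1..n}" unfolding \<psi> \<Theta>_def by (rule PiE_mem[OF \<phi>(1)])
    next
      fix l assume "l \<notin> swap_tag t ` V"
      then have "swap_tag t l \<notin> V" by (metis image_eqI swap_tag_involutive)
      then show "\<psi> l = undefined" unfolding \<psi> \<Theta>_def by (rule PiE_arb[OF \<phi>(1)])
    qed
    moreover have "map_entry \<psi> ` swap_entry t ` P \<subseteq> swap_entry t ` L"
      using \<phi>(2) t by (auto simp: \<psi> \<Theta>_def map_entry_swap)
    moreover have "l = l'" if "l \<in> swap_tag t ` V" "l' \<in> swap_tag t ` V" "fst l = fst l'" "\<psi> l = \<psi> l'" for l l'
    proof -
      have "swap_tag t l \<in> V" "swap_tag t l' \<in> V" using that by auto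
      moreover have "fst (swap_tag t l) = fst (swap_tag t l')" using that(3) by (cases l; cases l') (simp add: swap_tag_def)
      ultimately have "swap_tag t l = swap_tag t l'" using \<phi>(3) that(4) by (simp add: \<psi> \<Theta>_def)
      then show ?thesis by (metis swap_tag_involutive)
    qed
    ultimately show "\<psi> \<in> embs n (swap_entry t ` L) (swap_tag t ` V) (swap_entry t ` P)"
      unfolding embs_def homs_def by blast
  qed
  have inv: "\<Theta> (\<Theta> \<phi>) = \<phi>" for \<phi> by (simp add: \<Theta>_def)
  have "bij_betw \<Theta> (embs n L V P) (embs n (swap_entry t ` L) (swap_tag t ` V) (swap_entry t ` P))"
    by (rule bij_betw_byWitness[where f' = \<Theta>])
      (use map[of L V P] map[of "swap_entry t ` L" "swap_tag t ` V" "swap_entry t ` P"] t in \<open>auto simp: inv\<close>)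
  then show ?thesis by (simp add: bij_betw_same_card)
qed

lemma abundant_swap:
  assumes t: "t < 3" and ab: "abundant V P"
  shows "abundant (swap_tag t ` V) (swap_entry t ` P)"
proof -
  have cV: "card (swap_tag t ` V) = card V" by (rule card_image[OF inj_on_subset[OF inj_swap_tag]]) simp
  have cP: "card (swap_entry t ` P) = card P" by (rule card_image[OF inj_on_subset[OF inj_swap_entry[OF t]]]) simp
  have "bij_betw (\<lambda>L. swap_entry t ` L) (few_embs n \<epsilon> V P) (few_embs n \<epsilon> (swap_tag t ` V) (swap_entry t ` P))" for n \<epsilon>
  proof (rule bij_betw_byWitness[where f' = "\<lambda>L. swap_entry t ` L"])
    show "(\<lambda>L. swap_entry t ` L) ` few_embs n \<epsilon> V P \<subseteq> few_embs n \<epsilon> (swap_tag t ` V) (swap_entry t ` P)"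
      using t by (auto simp: few_embs_def cV cP card_embs_swap latin_square_swap)
    show "(\<lambda>L. swap_entry t ` L) ` few_embs n \<epsilon> (swap_tag t ` V) (swap_entry t ` P) \<subseteq> few_embs n \<epsilon> V P"
    proof
      fix L' assume "L' \<in> (\<lambda>L. swap_entry t ` L) ` few_embs n \<epsilon> (swap_tag t ` V) (swap_entry t ` P)"
      then obtain L where L': "L' = swap_entry t ` L" and L: "L \<in> few_embs n \<epsilon> (swap_tag t ` V) (swap_entry t ` P)" by blast
      have "L = swap_entry t ` L'" using t by (simp add: L')
      then have "card (embs n L (swap_tag t ` V) (swap_entry t ` P)) = card (embs n L' V P)"
        using card_embs_swap[OF t, of n L' V P] by simp
      then show "L' \<in> few_embs n \<epsilon> V P"
        using L latin_square_swap[OF t, of n L] by (simp add: few_embs_def cV cP L')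
    qed
  qed (use t in simp_all)
  then have "card (few_embs n \<epsilon> (swap_tag t ` V) (swap_entry t ` P)) = card (few_embs n \<epsilon> V P)" for n \<epsilon>
    using bij_betw_same_card by metis
  then show ?thesis using ab by (simp add: abundant_def)
qed

text \<open>Induction on the entries: the line of its own of \<open>g\<close> is turned into a
  symbol, \<open>abundant_step\<close> restores \<open>g\<close>, and the roles are swapped back.
  \<open>V\<close> is arbitrary because the other two lines of \<open>g\<close> stay behind even if
  they become isolated.\<close>

lemma abundant_sparse:
  assumes "finite P" "finite V" "lines_of P \<subseteq> V" "sparse_entries P" "partial_latin_square n\<^sub>0 P"
  shows "abundant V P"
  using assms
proof (induction "card P" arbitrary: P V)
  case 0
  then show ?case by (simp add: abundant_empty)
next
  case (Suc m)
  have "P \<noteq> {}" using Suc.hyps(2) by auto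
  then obtain g i where g: "g \<in> P" "i < 3" and new: "(i, coord i g) \<notin> lines_of (P - {g})"
    using sparse_degenerate Suc.prems by blast
  note t = g(2)
  let ?V = "swap_tag i ` V" and ?P = "swap_entry i ` P" and ?g = "swap_entry i g"
  have tag: "swap_tag i (i, coord i g) = (2, coord 2 ?g)"
    using t by (simp add: swap_tag_def coord_swap_entry)
  have Pg: "?P - {?g} = swap_entry i ` (P - {g})"
    using inj_swap_entry[OF t] by (simp add: image_set_diff)
  have Vl: "?V - {(2, coord 2 ?g)} = swap_tag i ` (V - {(i, coord i g)})"
    unfolding tag[symmetric] using inj_swap_tag by (simp add: image_set_diff)
  have "abundant (V - {(i, coord i g)}) (P - {g})"
  proof (rule Suc.hyps(1))
    show "m = card (P - {g})" using Suc.hyps(2) Suc.prems(1) g by simp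
    show "lines_of (P - {g}) \<subseteq> V - {(i, coord i g)}"
      using new lines_of_mono[of "P - {g}" P] Suc.prems(3) by blast
    show "sparse_entries (P - {g})" by (rule sparse_subset[OF Suc.prems(4)]) blast
    show "partial_latin_square n\<^sub>0 (P - {g})" by (rule partial_latin_square_subset[OF Suc.prems(5)]) blast
  qed (use Suc.prems in auto)
  then have "abundant (?V - {(2, coord 2 ?g)}) (?P - {?g})"
    unfolding Vl Pg by (rule abundant_swap[OF t])
  moreover have "(2, coord 2 ?g) \<notin> lines_of (?P - {?g})"
    unfolding Pg lines_of_swap[OF t] tag[symmetric] inj_image_mem_iff[OF inj_swap_tag] by (rule new)
  moreover have "lines_of ?P \<subseteq> ?V" unfolding lines_of_swap[OF t] by (intro image_mono Suc.prems(3))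
  ultimately have "abundant ?V ?P"
    using Suc.prems t g
    by (intro abundant_step[of ?V ?P ?g n\<^sub>0] sparse_swap partial_latin_square_swap) auto
  then have "abundant (swap_tag i ` ?V) (swap_entry i ` ?P)" by (rule abundant_swap[OF t])
  then show ?case using t by simp
qed

section \<open>From density to sparseness and from embeddings to isotopic copies\<close>

lemma extend_to_permutation:
  assumes "finite S" "A \<subseteq> S" "inj_on f A" "f ` A \<subseteq> S"
  shows "\<exists>p. p permutes S \<and> (\<forall>x\<in>A. p x = f x)"
proof -
  have "card (S - A) = card (S - f ` A)"
    using assms finite_subset[OF assms(2,1)] by (simp add: card_Diff_subset card_image)
  then obtain h where h: "bij_betw h (S - A) (S - f ` A)"
    using assms(1) by (metis finite_same_card_bij finite_Diff)
  define p where "p x = (if x \<in> A then f x else if x \<in> S then h x else x)" for x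
  have "bij_betw p A (f ` A)"
    using assms(3) by (simp add: p_def bij_betw_def inj_on_def)
  moreover have "bij_betw p (S - A) (S - f ` A)"
    using h by (rule bij_betw_cong[THEN iffD1, rotated]) (auto simp: p_def)
  ultimately have "bij_betw p (A \<union> (S - A)) (f ` A \<union> (S - f ` A))"
    by (rule bij_betw_combine) blast
  then have "bij_betw p S S" using assms(2,4) by (simp add: Un_absorb1)
  then have "p permutes S"
    by (rule bij_imp_permutes) (use assms(2) in \<open>auto simp: p_def\<close>)
  moreover have "\<forall>x\<in>A. p x = f x" by (simp add: p_def)
  ultimately show ?thesis by blast
qed

lemma coord_images: "rows_of P = coord 0 ` P" "cols_of P = coord 1 ` P" "syms_of P = coord 2 ` P"
  by (force simp: rows_of_def cols_of_def syms_of_def coord_def image_iff)+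

lemma sparse_if_density:
  assumes "finite P" and "pls_density P > 1 / 2"
  shows "sparse_entries P"
  unfolding sparse_entries_def
proof (intro allI impI)
  fix F assume F: "F \<subseteq> P" "F \<noteq> {}"
  let ?d = "\<lambda>P'. (real (card (rows_of P')) + real (card (cols_of P')) + real (card (syms_of P'))
             - real (card P')) / real (card P')"
  have finF: "finite F" using F assms(1) finite_subset by blast
  then have pos: "card F > 0" using F by (simp add: card_gt_0_iff)
  \<comment> \<open>As an image of a finite power set the set is finite, so that \<open>Min\<close>
    is a true lower bound.\<close>
  have "{?d P' | P'. P' \<noteq> {} \<and> P' \<subseteq> P} = ?d ` (Pow P - {{}})" by blast
  then have "finite {?d P' | P'. P' \<noteq> {} \<and> P' \<subseteq> P}" using assms(1) by simp
  then have "pls_density P \<le> ?d F" unfolding pls_density_def by (rule Min_le) (use F in blast)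
  then have "1 / 2 < ?d F" using assms(2) by linarith
  moreover have "card (lines_of F) = card (rows_of F) + card (cols_of F) + card (syms_of F)"
    unfolding coord_images by (rule card_lines_of[OF finF])
  ultimately show "3 * card F < 2 * card (lines_of F)"
    using pos by (simp add: field_simps)
qed

text \<open>An embedding is injective on the lines of each type separately, which is what its
  extension to three permutations requires.\<close>

lemma isotopic_copy_of_emb:
  assumes P: "partial_latin_square n P" and L: "latin_square n L" and \<phi>: "\<phi> \<in> embs n L (lines_of P) P"
  shows "\<exists>Q. isotopic n P Q \<and> Q \<subseteq> L"
proof -
  have ex: "\<exists>p. p permutes {1..n} \<and> (\<forall>x\<in>coord i ` P. p x = \<phi> (i, x))" if i: "i < 3" for i
  proof -
    have l: "(i, x) \<in> lines_of P" if "x \<in> coord i ` P" for x using that i by (auto simp: mem_lines_of)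
    have "coord i ` P \<subseteq> {1..n}"
    proof
      fix x assume "x \<in> coord i ` P"
      then obtain r c s where "(r, c, s) \<in> P" "x = coord i (r, c, s)" by auto
      then show "x \<in> {1..n}" using partial_latin_squareD(1)[OF P] by (auto simp: coord_def)
    qed
    moreover have "inj_on (\<lambda>x. \<phi> (i, x)) (coord i ` P)"
    proof (rule inj_onI)
      fix x y assume xy: "x \<in> coord i ` P" "y \<in> coord i ` P" "\<phi> (i, x) = \<phi> (i, y)"
      have "\<forall>l\<in>lines_of P. \<forall>l'\<in>lines_of P. fst l = fst l' \<and> \<phi> l = \<phi> l' \<longrightarrow> l = l'"
        using \<phi> by (simp add: embs_def)
      then have "(i, x) = (i, y)" using l[OF xy(1)] l[OF xy(2)] xy(3) by (metis fst_conv)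
      then show "x = y" by simp
    qed
    moreover have "(\<lambda>x. \<phi> (i, x)) ` coord i ` P \<subseteq> {1..n}"
      using \<phi> l unfolding embs_def homs_def by blast
    ultimately show ?thesis
      by (rule extend_to_permutation[OF finite_atLeastAtMost])
  qed
  obtain \<rho> where \<rho>: "\<rho> permutes {1..n}" "\<forall>x\<in>coord 0 ` P. \<rho> x = \<phi> (0, x)" using ex[of 0] by auto
  obtain \<gamma> where \<gamma>: "\<gamma> permutes {1..n}" "\<forall>x\<in>coord 1 ` P. \<gamma> x = \<phi> (1, x)" using ex[of 1] by auto
  obtain \<sigma> where \<sigma>: "\<sigma> permutes {1..n}" "\<forall>x\<in>coord 2 ` P. \<sigma> x = \<phi> (2, x)" using ex[of 2] by auto
  define Q where "Q = (\<lambda>(r, c, s). (\<rho> r, \<gamma> c, \<sigma> s)) ` P"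
  have "(case e of (r, c, s) \<Rightarrow> (\<rho> r, \<gamma> c, \<sigma> s)) = map_entry \<phi> e" if "e \<in> P" for e
    using \<rho>(2)[rule_format, OF imageI[OF that]] \<gamma>(2)[rule_format, OF imageI[OF that]]
      \<sigma>(2)[rule_format, OF imageI[OF that]]
    by (cases e) (simp add: map_entry_def coord_def)
  then have "Q = map_entry \<phi> ` P" unfolding Q_def by (rule image_cong[OF refl])
  then have QL: "Q \<subseteq> L" using \<phi> by (simp add: embs_def homs_def)
  have "partial_latin_square n Q"
    using L QL partial_latin_square_subset unfolding latin_square_def by blast
  then have "isotopic n P Q" unfolding isotopic_def using P \<rho>(1) \<gamma>(1) \<sigma>(1) Q_def by blast
  then show ?thesis using QL by blast
qed

theorem proposition1p9:
  fixes P :: "entry set" and n\<^sub>0 :: nat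
  assumes "partial_latin_square n\<^sub>0 P"
    and "P \<noteq> {}"
    and "pls_density P > 1 / 2"
  shows "(\<lambda>n. measure_pmf.prob (random_latin_square n) {L. \<exists>Q. isotopic n P Q \<and> Q \<subseteq> L})
           \<longlonglongrightarrow> 1"
proof -
  define V where "V = lines_of P"
  define A where "A n = {L. \<exists>Q. isotopic n P Q \<and> Q \<subseteq> L}" for n
  \<comment> \<open>The 1 / 2 stands for any value strictly between 0 and 1: a single embedding
    suffices.\<close>
  define x where "x n = real (card (few_embs n (1 / 2) V P)) / card {L. latin_square n L}" for n
  have finP: "finite P"
    by (rule finite_subset[of _ "{1..n\<^sub>0} \<times> {1..n\<^sub>0} \<times> {1..n\<^sub>0}"])
      (use assms(1) in \<open>simp_all add: partial_latin_square_def\<close>)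
  have "abundant V P"
    using finP assms(1) sparse_if_density[OF finP assms(3)] unfolding V_def
    by (intro abundant_sparse) auto
  then have x0: "x \<longlonglongrightarrow> 0" unfolding x_def[abs_def] abundant_def by simp
  have lower: "1 - x n \<le> measure_pmf.prob (random_latin_square n) (A n)" if n: "n > n\<^sub>0" for n
  proof -
    let ?LS = "{L. latin_square n L}"
    have Pn: "partial_latin_square n P"
    proof -
      note p = assms(1)[unfolded partial_latin_square_def]
      have "{1..n\<^sub>0} \<times> {1..n\<^sub>0} \<times> {1..n\<^sub>0} \<subseteq> {1..n} \<times> {1..n} \<times> {1..n}" using n by auto
      then have "P \<subseteq> {1..n} \<times> {1..n} \<times> {1..n}" by (rule subset_trans[OF conjunct1[OF p]])
      then show ?thesis unfolding partial_latin_square_def using conjunct2[OF p] by (rule conjI)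
    qed
    have "?LS \<subseteq> few_embs n (1 / 2) V P \<union> (?LS \<inter> A n)"
    proof
      fix L assume L: "L \<in> ?LS"
      show "L \<in> few_embs n (1 / 2) V P \<union> (?LS \<inter> A n)"
      proof (cases "embs n L V P = {}")
        \<comment> \<open>Here n is positive because it exceeds \<open>n\<^sub>0\<close>, so the
          count 0 lies strictly below the threshold of \<open>few_embs\<close>.\<close>
        case True
        then show ?thesis using L n by (simp add: few_embs_def)
      next
        case False
        then obtain \<phi> where "\<phi> \<in> embs n L V P" by blast
        then have "L \<in> A n" using isotopic_copy_of_emb[OF Pn, of L \<phi>] L by (simp add: A_def V_def)
        then show ?thesis using L by simp
      qed
    qed
    then have "card ?LS \<le> card (few_embs n (1 / 2) V P \<union> (?LS \<inter> A n))"
      using finite_latin_squares[of n] by (intro card_mono) (auto simp: few_embs_def)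
    also have "\<dots> \<le> card (few_embs n (1 / 2) V P) + card (?LS \<inter> A n)" by (rule card_Un_le)
    finally have "real (card ?LS) \<le> real (card (few_embs n (1 / 2) V P)) + real (card (?LS \<inter> A n))" by linarith
    moreover have N: "card ?LS > 0"
      using latin_squares_nonempty[of n] finite_latin_squares[of n] by (simp only: card_gt_0_iff not_False_eq_True simp_thms)
    moreover have "measure_pmf.prob (random_latin_square n) (A n) = real (card (?LS \<inter> A n)) / card ?LS"
      unfolding random_latin_square_def
      by (rule measure_pmf_of_set[OF latin_squares_nonempty finite_latin_squares])
    ultimately show ?thesis by (simp add: x_def field_simps)
  qed
  have "(\<lambda>n. 1 - x n) \<longlonglongrightarrow> 1 - 0" by (intro tendsto_diff tendsto_const x0)
  then have lim: "(\<lambda>n. 1 - x n) \<longlonglongrightarrow> 1" by simp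
  have "(\<lambda>n. measure_pmf.prob (random_latin_square n) (A n)) \<longlonglongrightarrow> 1"
  proof (rule tendsto_sandwich[OF _ _ lim tendsto_const])
    show "eventually (\<lambda>n. 1 - x n \<le> measure_pmf.prob (random_latin_square n) (A n)) sequentially"
      using eventually_gt_at_top[of n\<^sub>0] by (rule eventually_mono) (rule lower)
  qed simp
  then show ?thesis unfolding A_def .
qed

end
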